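(* Let $\mathcal X$ and $\mathcal Y$ be two compact subsets of $\mathbb R$, $\mu\in\mathcal P(\mathcal X)$, $\nu\in\mathcal P(\mathcal Y)$, and suppose that $\bar q\in\mathcal Q(\mu,\nu)$ is a kernel solution of the transport problem $\mathcal I_c(\mu,\nu)$ with cost function $$c(x,m)=G\left(\int F(x,y)\,m(dy)\right),\qquad x\in\mathcal X,\ m\in\mathcal M(\mathcal Y),$$ where $G:[0,+\infty)\to\mathbb R$ is convex and differentiable on $(0,+\infty)$, with $G'(0):=\lim_{u\to0^+}G'(u)\in\mathbb R\cup\{-\infty\}$, and $c$ is jointly lower semicontinuous. For all $x\in\mathcal X$, denote by $S_x\subset\mathcal Y$ the support of $\bar q^x$. Suppose also that $F:\mathbb R\times\mathbb R\to(0,+\infty)$ is twice continuously differentiable and such that $$\frac{\partial^2\ln F(x,y)}{\partial x\,\partial y}<0,\qquad\forall x,y\in\mathbb R.$$ (1) If $G$ is increasing on $[0,+\infty)$, then there exists $A\subset\mathcal X$ with $\mu(A)=1$ such that $$x_1<x_2,\ x_1,x_2\in A\ \Rightarrow\ \forall y_1\in S_{x_1},\ \forall y_2\in S_{x_2},\ y_1\le y_2.\qquad(M_+)$$ (2) If $G$ is decreasing on $[0,+\infty)$ and $G'(0)>-\infty$, then there exists $A\subset\mathcal X$ with $\mu(A)=1$ such that $$x_1<x_2,\ x_1,x_2\in A\ \Rightarrow\ \forall y_1\in S_{x_1},\ \forall y_2\in S_{x_2},\ y_1\ge y_2.\qquad(M_-)$$ The same conclusion holds if $G'(0)=-\infty$,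 provided $\mathcal Y$ is a finite set. If $\mu$ has no atoms and full support, then there exists a unique right-continuous map $\bar T:\mathcal X\to\mathcal Y$, which is non-decreasing when $G$ is increasing and non-increasing when $G$ is decreasing, such that any kernel solution $\tilde q\in\mathcal Q(\mu,\nu)$ of the transport problem can be written as $$\tilde q^x(dy)=\tilde N(x)\,\delta_{\bar T(x)}(dy)$$ for $\mu$-almost all $x\in\mathcal X$, with $\tilde N:\mathcal X\to\mathbb R_+$ a density with respect to $\mu$. If $G$ is assumed to be strictly convex, the density $\tilde N$ is also unique. If instead $F$ is such that $\frac{\partial^2\ln F(x,y)}{\partial x\,\partial y}>0$ for all $x,y\in\mathbb R$, all conclusions are reversed: $(M_+)$ holds when $G$ is decreasing, $(M_-)$ holds when $G$ is increasing, and the monotonicity of $\bar T$ is the opposite of that of $G$.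
   Context: $\mathcal P(E)$ is the set of Borel probability measures on $E$; $\mathcal M(\mathcal Y)$ is the set of finite nonnegative Borel measures on $\mathcal Y$, with the weak topology. Full support means $\mathrm{Supp}(\mu)=\mathcal X$. A nonnegative kernel is a family $q=(q^x)_{x\in\mathcal X}$ in $\mathcal M(\mathcal Y)$ with $x\mapsto q^x(A)$ measurable for all Borel $A\subset\mathcal Y$. $\mathcal Q(\mu,\nu)$ is the set of nonnegative kernels with $\int q^x(dy)\,\mu(dx)=\nu(dy)$, and $\mathcal I_c(\mu,\nu)=\inf_{q\in\mathcal Q(\mu,\nu)}\int c(x,q^x)\,\mu(dx)$. A kernel solution is a $q\in\mathcal Q(\mu,\nu)$ attaining this infimum. "Increasing" and "decreasing" are strict, as opposed to "non-decreasing" and "non-increasing".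
   Formalization: Uniqueness of T is false as stated (e.g. at max X, or where all solutions vanish); it is asserted only at x where some kernel solution is nonzero on a positive-μ part of every (x,x+e). The proviso of (2) is also kept for decreasing G in the map and reversed parts. *)

theory Defs
  imports "HOL-Probability.Probability"
begin

section \<open>Measures on a subset of a topological space\<close>

definition finite_measures :: "'a::topological_space set \<Rightarrow> 'a measure set" where
  "finite_measures E = {m. sets m = sets (restrict_space borel E) \<and> finite_measure m}"

definition prob_measures :: "'a::topological_space set \<Rightarrow> 'a measure set" where
  "prob_measures E = {m. sets m = sets (restrict_space borel E) \<and> prob_space m}"

definition measure_support :: "'a::topological_space measure \<Rightarrow> 'a set" where
  "measure_support m =
     {y \<in> space m. \<forall>U. open U \<longrightarrow> y \<in> U \<longrightarrow> emeasure m (U \<inter> space m) > 0}"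

text \<open>The coarsest topology on \<open>finite_measures E\<close> for which integration of every bounded
  continuous real function on \<open>E\<close> is continuous.\<close>

definition weak_topology :: "'a::topological_space set \<Rightarrow> 'a measure topology" where
  "weak_topology E = topology_generated_by
     {{m \<in> finite_measures E. (\<integral>y. f y \<partial>m) \<in> U} | (f :: 'a \<Rightarrow> real) U.
        continuous_on E f \<and> bounded (f ` E) \<and> open U}"

lemma topspace_weak_topology: "topspace (weak_topology E) = finite_measures E"
proof -
  have "finite_measures E \<in> {{m \<in> finite_measures E. (\<integral>y. f y \<partial>m) \<in> U} | (f :: 'a \<Rightarrow> real) U.
        continuous_on E f \<and> bounded (f ` E) \<and> open U}"
    by (intro CollectI exI[of _ "\<lambda>_. 0"] exI[of _ UNIV]) (auto simp: bounded_iff)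
  then show ?thesis
    unfolding weak_topology_def topology_generated_by_topspace by blast
qed

definition lower_semicontinuous_map :: "'a topology \<Rightarrow> ('a \<Rightarrow> real) \<Rightarrow> bool" where
  "lower_semicontinuous_map T f \<longleftrightarrow> (\<forall>a. openin T {z \<in> topspace T. a < f z})"

section \<open>Analytic notions\<close>

definition strictly_convex_on :: "real set \<Rightarrow> (real \<Rightarrow> real) \<Rightarrow> bool" where
  "strictly_convex_on S f \<longleftrightarrow> convex S \<and>
     (\<forall>u\<in>S. \<forall>v\<in>S. \<forall>t. u \<noteq> v \<longrightarrow> 0 < t \<longrightarrow> t < 1 \<longrightarrow>
        f ((1 - t) * u + t * v) < (1 - t) * f u + t * f v)"

definition twice_continuously_differentiable :: "('a::real_normed_vector \<Rightarrow> real) \<Rightarrow> bool" where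
  "twice_continuously_differentiable f \<longleftrightarrow>
     (\<exists>(f' :: 'a \<Rightarrow> 'a \<Rightarrow>\<^sub>L real) (f'' :: 'a \<Rightarrow> 'a \<Rightarrow>\<^sub>L 'a \<Rightarrow>\<^sub>L real).
        (\<forall>z. (f has_derivative blinfun_apply (f' z)) (at z)) \<and>
        (\<forall>z. (f' has_derivative blinfun_apply (f'' z)) (at z)) \<and>
        continuous_on UNIV f'')"

definition mixed_log_derivative :: "(real \<Rightarrow> real \<Rightarrow> real) \<Rightarrow> real \<Rightarrow> real \<Rightarrow> real" where
  "mixed_log_derivative F x y = deriv (\<lambda>s. deriv (\<lambda>t. ln (F s t)) y) x"

section \<open>Transport with nonnegative kernels\<close>

definition nonneg_kernel ::
    "'a::topological_space set \<Rightarrow> 'b::topological_space set \<Rightarrow> ('a \<Rightarrow> 'b measure) \<Rightarrow> bool" where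
  "nonneg_kernel X Y q \<longleftrightarrow>
     (\<forall>x\<in>X. q x \<in> finite_measures Y) \<and>
     (\<forall>A\<in>sets (restrict_space borel Y).
        (\<lambda>x. emeasure (q x) A) \<in> borel_measurable (restrict_space borel X))"

definition transport_kernels ::
    "'a::topological_space measure \<Rightarrow> 'b::topological_space measure \<Rightarrow> ('a \<Rightarrow> 'b measure) set" where
  "transport_kernels \<mu> \<nu> =
     {q. nonneg_kernel (space \<mu>) (space \<nu>) q \<and>
         (\<forall>A\<in>sets \<nu>. (\<integral>\<^sup>+x. emeasure (q x) A \<partial>\<mu>) = emeasure \<nu> A)}"

text \<open>The integral of \<open>x \<mapsto> c(x, q\<^sup>x)\<close> as positive part minus negative part, with values in the
  extended reals.  For the costs considered below the negative part has finite integral: \<open>G\<close> is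
  bounded below by an affine function, and the total mass of \<open>q\<^sup>x\<close> integrates to 1.\<close>

definition kernel_cost ::
    "('a \<Rightarrow> 'b measure \<Rightarrow> real) \<Rightarrow> 'a measure \<Rightarrow> ('a \<Rightarrow> 'b measure) \<Rightarrow> ereal" where
  "kernel_cost c \<mu> q =
     enn2ereal (\<integral>\<^sup>+x. ennreal (c x (q x)) \<partial>\<mu>) - enn2ereal (\<integral>\<^sup>+x. ennreal (- c x (q x)) \<partial>\<mu>)"

definition transport_value ::
    "('a::topological_space \<Rightarrow> 'b::topological_space measure \<Rightarrow> real) \<Rightarrow>
     'a measure \<Rightarrow> 'b measure \<Rightarrow> ereal" where
  "transport_value c \<mu> \<nu> = (INF q\<in>transport_kernels \<mu> \<nu>. kernel_cost c \<mu> q)"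

definition kernel_solution ::
    "('a::topological_space \<Rightarrow> 'b::topological_space measure \<Rightarrow> real) \<Rightarrow>
     'a measure \<Rightarrow> 'b measure \<Rightarrow> ('a \<Rightarrow> 'b measure) \<Rightarrow> bool" where
  "kernel_solution c \<mu> \<nu> q \<longleftrightarrow>
     q \<in> transport_kernels \<mu> \<nu> \<and> kernel_cost c \<mu> q = transport_value c \<mu> \<nu>"

definition integral_cost ::
    "(real \<Rightarrow> real) \<Rightarrow> ('a \<Rightarrow> 'b \<Rightarrow> real) \<Rightarrow> 'a \<Rightarrow> 'b measure \<Rightarrow> real" where
  "integral_cost G F x m = G (\<integral>y. F x y \<partial>m)"

section \<open>Monotone structure of kernel solutions\<close>

text \<open>Condition \<open>M\<^sub>+\<close> is the case where \<open>le\<close> is \<open>(\<le>)\<close>, condition \<open>M\<^sub>-\<close> the case where it is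
  \<open>(\<ge>)\<close>.  The support of the zero measure is empty.\<close>

definition supports_ordered ::
    "(real \<Rightarrow> real \<Rightarrow> bool) \<Rightarrow> real measure \<Rightarrow> (real \<Rightarrow> real measure) \<Rightarrow> bool" where
  "supports_ordered le \<mu> q \<longleftrightarrow>
     (\<exists>A\<in>sets \<mu>. emeasure \<mu> A = 1 \<and>
        (\<forall>x1\<in>A. \<forall>x2\<in>A. x1 < x2 \<longrightarrow>
           (\<forall>y1\<in>measure_support (q x1). \<forall>y2\<in>measure_support (q x2). le y1 y2)))"

definition represents_kernel ::
    "real measure \<Rightarrow> real measure \<Rightarrow> (real \<Rightarrow> real) \<Rightarrow> (real \<Rightarrow> real) \<Rightarrow> (real \<Rightarrow> real measure) \<Rightarrow> bool" where
  "represents_kernel \<mu> \<nu> T N q \<longleftrightarrow>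
     N \<in> borel_measurable \<mu> \<and> (\<forall>x\<in>space \<mu>. 0 \<le> N x) \<and> (\<integral>\<^sup>+x. ennreal (N x) \<partial>\<mu>) = 1 \<and>
     (AE x in \<mu>. q x = scale_measure (ennreal (N x)) (return (restrict_space borel (space \<nu>)) (T x)))"

text \<open>Monotone right-continuous maps \<open>T\<close> from \<open>space \<mu>\<close> to \<open>space \<nu>\<close> through which all kernel
  solutions factor; non-decreasing if \<open>le\<close> is \<open>(\<le>)\<close>, non-increasing if \<open>le\<close> is \<open>(\<ge>)\<close>.\<close>

definition solution_map ::
    "(real \<Rightarrow> real \<Rightarrow> bool) \<Rightarrow> (real \<Rightarrow> real measure \<Rightarrow> real) \<Rightarrow>
     real measure \<Rightarrow> real measure \<Rightarrow> (real \<Rightarrow> real) \<Rightarrow> bool" where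
  "solution_map le c \<mu> \<nu> T \<longleftrightarrow>
     T \<in> space \<mu> \<rightarrow> space \<nu> \<and>
     monotone_on (space \<mu>) (\<le>) le T \<and>
     (\<forall>x\<in>space \<mu>. continuous (at x within space \<mu> \<inter> {x..}) T) \<and>
     (\<forall>q. kernel_solution c \<mu> \<nu> q \<longrightarrow> (\<exists>N. represents_kernel \<mu> \<nu> T N q))"

text \<open>The values of a right-continuous map at points immediately to the right of which no kernel
  solution puts any mass are not constrained by the kernel solutions: there \<open>N\<close> vanishes and
  \<open>N(x) \<delta>\<^bsub>T(x)\<^esub>\<close> does not depend on \<open>T(x)\<close>.  This includes the points of \<open>space \<mu>\<close> that are
  isolated from the right, such as its maximum.  Uniqueness of the map is therefore understood on
  the remaining points, which form the following set.  If some kernel solution is nonzero at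
  \<open>\<mu>\<close>-almost every point and \<open>\<mu>\<close> has full support, the set consists of all points of
  \<open>space \<mu>\<close> that are not isolated from the right.\<close>

definition charged_from_right ::
    "(real \<Rightarrow> real measure \<Rightarrow> real) \<Rightarrow> real measure \<Rightarrow> real measure \<Rightarrow> real set" where
  "charged_from_right c \<mu> \<nu> =
     {x \<in> space \<mu>. \<forall>e>0. \<exists>q. kernel_solution c \<mu> \<nu> q \<and>
        emeasure \<mu> {t \<in> space \<mu>. x < t \<and> t < x + e \<and> emeasure (q t) (space \<nu>) > 0} > 0}"

definition unique_solution_map ::
    "(real \<Rightarrow> real \<Rightarrow> bool) \<Rightarrow> (real \<Rightarrow> real measure \<Rightarrow> real) \<Rightarrow>
     real measure \<Rightarrow> real measure \<Rightarrow> bool" where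
  "unique_solution_map le c \<mu> \<nu> \<longleftrightarrow>
     (\<exists>T. solution_map le c \<mu> \<nu> T \<and>
        (\<forall>T'. solution_map le c \<mu> \<nu> T' \<longrightarrow> (\<forall>x\<in>charged_from_right c \<mu> \<nu>. T' x = T x)))"

definition unique_solution_density ::
    "(real \<Rightarrow> real \<Rightarrow> bool) \<Rightarrow> (real \<Rightarrow> real measure \<Rightarrow> real) \<Rightarrow>
     real measure \<Rightarrow> real measure \<Rightarrow> bool" where
  "unique_solution_density le c \<mu> \<nu> \<longleftrightarrow>
     (\<forall>T q1 q2 N1 N2. solution_map le c \<mu> \<nu> T \<longrightarrow>
        kernel_solution c \<mu> \<nu> q1 \<longrightarrow> kernel_solution c \<mu> \<nu> q2 \<longrightarrow>
        represents_kernel \<mu> \<nu> T N1 q1 \<longrightarrow> represents_kernel \<mu> \<nu> T N2 q2 \<longrightarrow>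
        (AE x in \<mu>. N1 x = N2 x))"

end

theory Submission
  imports Defs
begin

text \<open>
Write \<open>u(x) = \<integral> F(x, y) q\<^sup>x(dy)\<close>, so that the cost of a kernel is \<open>\<integral> G(u) d\<mu>\<close>. Removing a small amount of mass
from the target \<open>y\<close> over base points near \<open>x\<^sub>1\<close> and adding it over base points near \<open>x\<^sub>2\<close> leaves both
marginals unchanged. To first order it changes the cost in proportion to
\<open>G'(u(x\<^sub>2)) F(x\<^sub>2, y) - G'(u(x\<^sub>1)) F(x\<^sub>1, y)\<close>. For a solution this cannot be negative if \<open>y\<close> is in the support of
\<open>q\<close> at \<open>x\<^sub>1\<close> (\<open>exchange_inequality\<close>, \<open>first_order_condition\<close>). The exchange needs sets of positive measure, so
the condition is obtained at typical points, which have full measure (\<open>AE_typical\<close>).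

Multiplying the conditions for \<open>(x\<^sub>1, y\<^sub>1)\<close> and \<open>(x\<^sub>2, y\<^sub>2)\<close> cancels the factors \<open>G'(u(x\<^sub>i))\<close>, which have the
common sign given by the monotonicity of \<open>G\<close>. A comparison of \<open>F(x\<^sub>1, y\<^sub>1) F(x\<^sub>2, y\<^sub>2)\<close> with
\<open>F(x\<^sub>1, y\<^sub>2) F(x\<^sub>2, y\<^sub>1)\<close> remains. The sign of \<open>\<partial>\<^sub>x \<partial>\<^sub>y ln F\<close> makes it strict in one direction, hence
orders \<open>y\<^sub>1\<close> and \<open>y\<^sub>2\<close> (\<open>ordered_by_exchange_inequalities\<close>). The supports over \<open>x\<^sub>1\<close> and \<open>x\<^sub>2\<close> both enter, so
neither measure vanishes and \<open>G'\<close> is taken at positive arguments.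

By convexity the midpoint of two solutions is again a solution. Its supports contain those of both, so the
supports of all solutions, taken at typical points, form one monotone relation (\<open>two_solutions_ordered\<close>).
Such a relation is the graph of a right-continuous monotone map up to countably many points
(\<open>monotone_relation_graph\<close>). When \<open>\<mu>\<close> has no atoms these are negligible, and all solutions are carried by this
one map. Uniqueness of the map follows from right-continuity. If \<open>G\<close> is strictly convex, equality in
the convexity inequality for the midpoint forces two solutions to have the same \<open>u\<close>; since
\<open>u(x) = N(x) F(x, T(x))\<close>, they then have the same density.
\<close>

section \<open>Almost every point and open sets\<close>

lemma exists_in_of_AE:
  assumes "0 < emeasure M A" "A \<in> sets M" "AE x in M. P x"
  shows "\<exists>x\<in>A. P x"
proof (rule ccontr)
  assume "\<not> (\<exists>x\<in>A. P x)"
  then have "AE x in M. x \<notin> A"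
    using assms(3) by (auto elim: eventually_mono)
  then have "emeasure M A = 0"
    using assms(2) AE_iff_measurable[of A M "\<lambda>x. x \<notin> A"] sets.sets_into_space by auto
  with assms(1) show False by simp
qed

lemma singleton_sets:
  fixes a :: "'a::t1_space"
  shows "a \<in> E \<Longrightarrow> {a} \<in> sets (restrict_space borel E)"
  using image_eqI[of "{a}" "(\<inter>) E" "{a}" "sets borel"] by (simp add: sets_restrict_space)

lemma enn2ereal_diff_nn_integrals:
  fixes f :: "'a \<Rightarrow> real"
  assumes "integrable M f"
  shows "enn2ereal (\<integral>\<^sup>+x. ennreal (f x) \<partial>M) - enn2ereal (\<integral>\<^sup>+x. ennreal (- f x) \<partial>M) = ereal (\<integral>x. f x \<partial>M)"
proof -
  have *: "enn2ereal r = ereal (enn2real r)" if "r \<noteq> \<infinity>" for r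
    using that by (metis enn2ereal_ennreal enn2real_nonneg ennreal_enn2real infinity_ennreal_def less_top)
  have "(\<integral>\<^sup>+x. ennreal (f x) \<partial>M) \<noteq> \<infinity>" "(\<integral>\<^sup>+x. ennreal (- f x) \<partial>M) \<noteq> \<infinity>"
    using assms by (auto simp: real_integrable_def)
  then show ?thesis
    using real_lebesgue_integral_def[OF assms] by (simp add: *)
qed

text \<open>Uncountably many open sets are tested at almost every point. This works because a point that
belongs to \<open>E W\<close> already belongs to \<open>E B\<close> for a set \<open>B \<subseteq> W\<close> of a fixed countable basis, so that the
exceptional points lie in countably many null sets. The lemma is applied twice: to the traces of open
sets on a measure, where it says that a measure is carried by its support, and to the sets of base
points at which a kernel charges a given open set.\<close>
lemma AE_union_preserving_family_pos:
  fixes E :: "'b::second_countable_topology set \<Rightarrow> 'a set"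
  assumes meas: "\<And>W. open W \<Longrightarrow> E W \<in> sets M"
    and union: "\<And>\<C>. countable \<C> \<Longrightarrow> (\<And>W. W \<in> \<C> \<Longrightarrow> open W) \<Longrightarrow> E (\<Union>\<C>) \<subseteq> \<Union>(E ` \<C>)"
    and mono: "\<And>W W'. open W \<Longrightarrow> open W' \<Longrightarrow> W \<subseteq> W' \<Longrightarrow> E W \<subseteq> E W'"
  shows "AE x in M. \<forall>W. open W \<longrightarrow> x \<in> E W \<longrightarrow> 0 < emeasure M (E W)"
proof -
  obtain \<B> :: "'b set set" where \<B>: "countable \<B>" "topological_basis \<B>"
    using ex_countable_basis by blast
  have op: "open W" if "W \<in> \<B>" for W
    using \<B>(2) that by (rule topological_basis_open)
  have "AE x in M. \<forall>W\<in>\<B>. x \<in> E W \<longrightarrow> 0 < emeasure M (E W)"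
  proof (subst AE_ball_countable[OF \<B>(1)], intro ballI)
    fix W assume W: "W \<in> \<B>"
    show "AE x in M. x \<in> E W \<longrightarrow> 0 < emeasure M (E W)"
    proof (cases "emeasure M (E W) = 0")
      case True
      then have "E W \<in> null_sets M" using meas[OF op[OF W]] by auto
      from AE_not_in[OF this] show ?thesis by eventually_elim simp
    next
      case False
      then show ?thesis by (simp add: zero_less_iff_neq_zero)
    qed
  qed
  then show ?thesis
  proof eventually_elim
    case (elim x)
    show ?case
    proof (intro allI impI)
      fix W assume W: "open W" "x \<in> E W"
      obtain \<C> where \<C>: "\<C> \<subseteq> \<B>" "\<Union>\<C> = W"
        using \<B>(2) W(1) unfolding topological_basis_def by blast
      have "x \<in> \<Union>(E ` \<C>)"
        using union[of \<C>] \<C> op W countable_subset[OF \<C>(1) \<B>(1)] by blast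
      then obtain W' where W': "W' \<in> \<C>" "x \<in> E W'" by blast
      have "0 < emeasure M (E W')" using elim W' \<C> by blast
      also have "\<dots> \<le> emeasure M (E W)"
        using W' \<C> op by (intro emeasure_mono mono meas W) auto
      finally show "0 < emeasure M (E W)" .
    qed
  qed
qed

lemma AE_in_measure_support:
  fixes m :: "'a::second_countable_topology measure"
  assumes "sets m = sets (restrict_space borel Y)"
  shows "AE y in m. y \<in> measure_support m"
proof -
  have sp: "space m = Y"
    using sets_eq_imp_space_eq[OF assms] by (simp add: space_restrict_space)
  have "AE y in m. \<forall>W. open W \<longrightarrow> y \<in> W \<inter> space m \<longrightarrow> 0 < emeasure m (W \<inter> space m)"
  proof (rule AE_union_preserving_family_pos)
    fix W :: "'a set" assume "open W"
    then show "W \<inter> space m \<in> sets m"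
      unfolding assms sp sets_restrict_space by auto
  qed auto
  with AE_space show ?thesis
    by eventually_elim (auto simp: measure_support_def)
qed

section \<open>Sums of measures and integration against kernels\<close>

definition add_measure :: "'a measure \<Rightarrow> 'a measure \<Rightarrow> 'a measure" where
  "add_measure m n = measure_of (space m) (sets m) (\<lambda>A. emeasure m A + emeasure n A)"

lemma sets_add_measure [simp]: "sets (add_measure m n) = sets m"
  and space_add_measure [simp]: "space (add_measure m n) = space m"
  by (auto simp: add_measure_def)

lemma emeasure_add_measure:
  assumes "sets n = sets m" "A \<in> sets m"
  shows "emeasure (add_measure m n) A = emeasure m A + emeasure n A"
  unfolding add_measure_def
proof (rule emeasure_measure_of_sigma)
  show "sigma_algebra (space m) (sets m)" by (rule sets.sigma_algebra_axioms)
  show "positive (sets m) (\<lambda>A. emeasure m A + emeasure n A)" by (simp add: positive_def)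
  show "countably_additive (sets m) (\<lambda>A. emeasure m A + emeasure n A)"
    using assms(1) by (auto simp: countably_additive_def suminf_add[symmetric] suminf_emeasure)
qed fact

lemma nn_integral_add_measure:
  assumes "sets n = sets m" and f: "f \<in> borel_measurable m"
  shows "(\<integral>\<^sup>+y. f y \<partial>add_measure m n) = (\<integral>\<^sup>+y. f y \<partial>m) + (\<integral>\<^sup>+y. f y \<partial>n)"
proof -
  have sp: "space n = space m" using assms(1) by (rule sets_eq_imp_space_eq)
  have M: "borel_measurable (add_measure m n) = borel_measurable m"
    "borel_measurable n = borel_measurable m"
    by (auto simp: assms(1) intro!: measurable_cong_sets)
  from f show ?thesis
  proof induct
    case (cong f g)
    then show ?case using nn_integral_cong[of "add_measure m n" f g]
      nn_integral_cong[of m f g] nn_integral_cong[of n f g] by (simp add: sp)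
  next
    case (set A)
    then show ?case using assms(1) by (simp add: emeasure_add_measure)
  next
    case (mult u c)
    then show ?case by (simp add: nn_integral_cmult M distrib_left)
  next
    case (add u v)
    then show ?case by (simp add: nn_integral_add M algebra_simps)
  next
    case (seq U)
    have "(\<integral>\<^sup>+y. (SUP i. U i) y \<partial>k) = (SUP i. \<integral>\<^sup>+y. U i y \<partial>k)"
      if "k \<in> {add_measure m n, m, n}" for k
      using seq that by (auto simp: image_comp intro!: nn_integral_monotone_convergence_SUP) (simp_all add: M)
    moreover have "incseq (\<lambda>i. \<integral>\<^sup>+y. U i y \<partial>k)" for k
      using \<open>incseq U\<close> by (fastforce simp: incseq_def le_fun_def intro!: nn_integral_mono)
    ultimately show ?case using seq(3) by (simp add: ennreal_SUP_add)
  qed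
qed

lemma integral_add_measure:
  fixes f :: "'a \<Rightarrow> real"
  assumes "sets n = sets m" "integrable m f" "integrable n f" "\<And>y. 0 \<le> f y"
  shows "(\<integral>y. f y \<partial>add_measure m n) = (\<integral>y. f y \<partial>m) + (\<integral>y. f y \<partial>n)"
proof -
  have f: "f \<in> borel_measurable m" "f \<in> borel_measurable n" "f \<in> borel_measurable (add_measure m n)"
    using assms(2,3) measurable_cong_sets[of "add_measure m n" m borel borel] by auto
  have "(\<integral>\<^sup>+y. ennreal (f y) \<partial>m) < \<infinity>" "(\<integral>\<^sup>+y. ennreal (f y) \<partial>n) < \<infinity>"
    using assms(2-4) by (auto simp: real_integrable_def less_top[symmetric])
  then show ?thesis
    using f assms(4) by (simp add: integral_eq_nn_integral nn_integral_add_measure[OF assms(1)] enn2real_plus)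
qed

text \<open>The Giry monad provides this for kernels of subprobabilities. A finite kernel reduces to that case
after division by the measurable and nowhere vanishing factor \<open>1 + q\<^sup>x(N)\<close>; the total masses need not be
bounded in \<open>x\<close>.\<close>
lemma measurable_nn_integral_finite_kernel:
  assumes fin: "\<And>x. x \<in> space M \<Longrightarrow> finite_measure (q x)"
    and sets: "\<And>x. x \<in> space M \<Longrightarrow> sets (q x) = sets N"
    and meas: "\<And>A. A \<in> sets N \<Longrightarrow> (\<lambda>x. emeasure (q x) A) \<in> borel_measurable M"
    and f: "case_prod f \<in> borel_measurable (M \<Otimes>\<^sub>M N)"
  shows "(\<lambda>x. \<integral>\<^sup>+y. f x y \<partial>q x) \<in> borel_measurable M"
proof (cases "space N = {}")
  case True
  then have "(\<integral>\<^sup>+y. f x y \<partial>q x) = 0" if "x \<in> space M" for x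
    using sets_eq_imp_space_eq[OF sets[OF that]] by (simp add: nn_integral_empty)
  then show ?thesis by (subst measurable_cong[where g = "\<lambda>_. 0"]) auto
next
  case ne: False
  \<comment> \<open>The summand 1 keeps the divisor away from zero, including where the kernel vanishes.\<close>
  define w where "w x = 1 + emeasure (q x) (space N)" for x
  have w [measurable]: "w \<in> borel_measurable M"
    unfolding w_def by (intro borel_measurable_add borel_measurable_const meas sets.top)
  have w_fin: "w x \<noteq> \<infinity>" "w x \<noteq> 0" if "x \<in> space M" for x
    using finite_measure.emeasure_finite[OF fin[OF that]] by (auto simp: w_def)
  define p where "p x = scale_measure (inverse (w x)) (q x)" for x
  have em: "emeasure (p x) A = inverse (w x) * emeasure (q x) A" for x A
    by (simp add: p_def)
  have p: "p \<in> measurable M (subprob_algebra N)"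
  proof (rule measurable_subprob_algebra)
    fix x assume x: "x \<in> space M"
    show "sets (p x) = sets N" using sets[OF x] by (simp add: p_def)
    have sp: "space (q x) = space N" "space (p x) = space N"
      using sets_eq_imp_space_eq[OF sets[OF x]] by (simp_all add: p_def space_scale_measure)
    show "subprob_space (p x)"
    proof
      have "inverse (w x) * emeasure (q x) (space N) \<le> inverse (w x) * w x"
        by (intro mult_left_mono) (auto simp: w_def)
      also have "\<dots> = 1" using w_fin[OF x]
        by (simp add: mult.commute[of "inverse (w x)"] divide_ennreal_def[symmetric] less_top)
      finally show "emeasure (p x) (space (p x)) \<le> 1" by (simp add: em sp)
      show "space (p x) \<noteq> {}"
        using sp(2) ne by simp
    qed
  next
    fix A assume "A \<in> sets N"
    then have [measurable]: "(\<lambda>x. emeasure (q x) A) \<in> borel_measurable M" by (rule meas)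
    show "(\<lambda>x. emeasure (p x) A) \<in> borel_measurable M"
      unfolding em by measurable
  qed
  have "(\<lambda>x. w x * (\<integral>\<^sup>+y. f x y \<partial>p x)) \<in> borel_measurable M"
    using nn_integral_measurable_subprob_algebra2[OF f p] by measurable
  also have "?this \<longleftrightarrow> ?thesis"
  proof (rule measurable_cong)
    fix x assume x: "x \<in> space M"
    have "f x \<in> borel_measurable (q x)"
      using measurable_compose[OF measurable_Pair1'[OF x] f] measurable_cong_sets[OF sets[OF x] refl] by (auto simp: comp_def)
    then have "w x * (\<integral>\<^sup>+y. f x y \<partial>p x) = w x * inverse (w x) * (\<integral>\<^sup>+y. f x y \<partial>q x)"
      by (simp add: p_def nn_integral_scale_measure mult.assoc)
    then show "w x * (\<integral>\<^sup>+y. f x y \<partial>p x) = (\<integral>\<^sup>+y. f x y \<partial>q x)"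
      using w_fin[OF x] by (simp add: divide_ennreal_def[symmetric] less_top)
  qed
  finally show ?thesis .
qed

section \<open>Convex functions on the half-line\<close>

lemma convex_above_tangent:
  fixes G :: "real \<Rightarrow> real"
  assumes "convex_on {0..} G" "G differentiable (at v)" "0 < v" "0 \<le> u"
  shows "G v + deriv G v * (u - v) \<le> G u"
proof -
  have "(G has_field_derivative deriv G v) (at v within {0..})"
    using assms(2) DERIV_deriv_iff_real_differentiable by (metis has_field_derivative_at_within)
  then have "G u - G v \<ge> deriv G v * (u - v)"
    using assms by (intro convex_on_imp_above_tangent[where A = "{0..}"]) (auto simp: )
  then show ?thesis by simp
qed

text \<open>Both half-continuities come from comparing \<open>G'(u)\<close> with a fixed difference quotient: by convexity
\<open>G'(u)\<close> lies above the quotients with negative step and below those with positive step, and a quotient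
with fixed step depends continuously on \<open>u\<close>.\<close>
lemma isCont_deriv_convex:
  fixes G :: "real \<Rightarrow> real"
  assumes G: "convex_on {0..} G" "\<forall>u>0. G differentiable (at u)" and v: "0 < v"
  shows "isCont (deriv G) v"
proof -
  have der: "(G has_real_derivative deriv G u) (at u)" if "0 < u" for u
    using G(2) that DERIV_deriv_iff_real_differentiable by blast
  have cont: "isCont G u" if "0 < u" for u using der[OF that] by (rule DERIV_isCont)
  have tan: "G a + deriv G a * (u - a) \<le> G u" if "0 < a" "0 \<le> u" for a u
    using convex_above_tangent[OF G(1)] G(2) that by auto
  have lim: "((\<lambda>h. (G (v + h) - G v) / h) \<longlongrightarrow> deriv G v) (at 0)"
    using der[OF v] by (simp add: DERIV_def)
  have difference_quotient:
    "((\<lambda>u. (G (u + h) - G u) / h) \<longlongrightarrow> (G (v + h) - G v) / h) (at v)"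
    if h: "h \<noteq> 0" "0 < v + h" for h
  proof -
    have "isCont (\<lambda>u. G (u + h)) v"
      using h by (intro isCont_o2[where g = G and f = "\<lambda>u. u + h"] cont) auto
    with cont[OF v] h show ?thesis
      unfolding isCont_def by (intro tendsto_divide tendsto_diff tendsto_const) auto
  qed
  show ?thesis
    unfolding isCont_def
  proof (rule order_tendstoI)
    fix a assume "a < deriv G v"
    then have "\<forall>\<^sub>F h in at 0. a < (G (v + h) - G v) / h"
      using lim by (rule order_tendstoD[rotated])
    then have "\<forall>\<^sub>F h in at_left 0. a < (G (v + h) - G v) / h"
      by (auto simp: eventually_at_split)
    moreover have "\<forall>\<^sub>F h in at_left 0. -v < h \<and> h < (0::real)"
      using v eventually_at_left_real[of "-v" 0] by (auto elim: eventually_mono)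
    ultimately have "\<forall>\<^sub>F h in at_left 0. -v < h \<and> h < 0 \<and> a < (G (v + h) - G v) / h"
      by eventually_elim auto
    then obtain h where h: "-v < h" "h < 0" "a < (G (v + h) - G v) / h"
      using eventually_happens'[OF trivial_limit_at_left_real] by blast
    have "((\<lambda>u. (G (u + h) - G u) / h) \<longlongrightarrow> (G (v + h) - G v) / h) (at v)"
      using h v by (intro difference_quotient) auto
    then have "\<forall>\<^sub>F u in at v. a < (G (u + h) - G u) / h"
      using h(3) by (rule order_tendstoD)
    moreover have "\<forall>\<^sub>F u in at v. - h < u"
      using h by (intro order_tendstoD(1)[OF tendsto_ident_at]) auto
    ultimately show "\<forall>\<^sub>F u in at v. a < deriv G u"
    proof eventually_elim
      case (elim u)
      then have "(G (u + h) - G u) / h \<le> deriv G u"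
        using tan[of u "u + h"] h by (auto simp: field_simps)
      with elim show ?case by simp
    qed
  next
    fix a assume "deriv G v < a"
    then have "\<forall>\<^sub>F h in at 0. (G (v + h) - G v) / h < a"
      using lim by (rule order_tendstoD[rotated])
    then have "\<forall>\<^sub>F h in at_right 0. (G (v + h) - G v) / h < a"
      by (auto simp: eventually_at_split)
    moreover have "\<forall>\<^sub>F h in at_right 0. (0::real) < h"
      by (simp add: eventually_at_right_less)
    ultimately have "\<forall>\<^sub>F h in at_right 0. 0 < h \<and> (G (v + h) - G v) / h < a"
      by eventually_elim auto
    then obtain h where h: "0 < h" "(G (v + h) - G v) / h < a"
      using eventually_happens'[OF trivial_limit_at_right_real] by blast
    have "((\<lambda>u. (G (u + h) - G u) / h) \<longlongrightarrow> (G (v + h) - G v) / h) (at v)"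
      using h v by (intro difference_quotient) auto
    then have "\<forall>\<^sub>F u in at v. (G (u + h) - G u) / h < a"
      using h(2) by (rule order_tendstoD)
    moreover have "\<forall>\<^sub>F u in at v. 0 < u"
      using v by (intro order_tendstoD(1)[OF tendsto_ident_at]) auto
    ultimately show "\<forall>\<^sub>F u in at v. deriv G u < a"
    proof eventually_elim
      case (elim u)
      then have "deriv G u \<le> (G (u + h) - G u) / h"
        using tan[of u "u + h"] h by (auto simp: field_simps)
      with elim show ?case by simp
    qed
  qed
qed

text \<open>A tangent with slope at most zero would force \<open>G\<close> not to increase just to the left of \<open>v\<close>.\<close>
lemma deriv_pos_if_convex_strict_mono:
  assumes G: "convex_on {0..} G" "\<forall>u>0. G differentiable (at u)" "strict_mono_on {0..} G" and v: "0 < v"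
  shows "0 < deriv G v"
proof (rule ccontr)
  assume "\<not> 0 < deriv G v"
  then have "G v \<le> G v + deriv G v * (v / 2 - v)"
    using v by (auto simp: not_less mult_le_0_iff)
  also have "\<dots> \<le> G (v / 2)" using G v by (intro convex_above_tangent) auto
  finally show False using strict_mono_onD[OF G(3), of "v / 2" v] v by auto
qed

lemma deriv_neg_if_convex_strict_antimono:
  assumes G: "convex_on {0..} G" "\<forall>u>0. G differentiable (at u)" "strict_antimono_on {0..} G" and v: "0 < v"
  shows "deriv G v < 0"
proof (rule ccontr)
  assume "\<not> deriv G v < 0"
  then have "G v \<le> G v + deriv G v * ((v + 1) - v)"
    by auto
  also have "\<dots> \<le> G (v + 1)" using G v by (intro convex_above_tangent) auto
  finally show False using monotone_onD[OF G(3), of v "v + 1"] v by auto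
qed

section \<open>Functions with a mixed logarithmic derivative of constant sign\<close>

text \<open>The sign of the mixed derivative makes \<open>s \<mapsto> k \<partial>\<^sub>y ln F(s, y)\<close> decreasing, hence the derivative in \<open>t\<close> of
\<open>k (ln F(x\<^sub>2, t) - ln F(x\<^sub>1, t))\<close> negative. The factor \<open>k\<close> is 1 or -1 later on, so that both signs of
the mixed derivative are covered.\<close>
lemma ln_rectangle_inequality:
  fixes F :: "real \<Rightarrow> real \<Rightarrow> real"
  assumes pos: "\<forall>x y. 0 < F x y"
    and C2: "twice_continuously_differentiable (\<lambda>(x, y). F x y)"
    and sgn: "\<forall>x y. k * mixed_log_derivative F x y < 0"
    and less: "x1 < x2" "y1 < y2"
  shows "k * (ln (F x1 y1) + ln (F x2 y2)) < k * (ln (F x1 y2) + ln (F x2 y1))"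
proof -
  from C2 obtain F' F'' where
    "(\<forall>z. ((\<lambda>(x, y). F x y) has_derivative blinfun_apply (F' z)) (at z)) \<and>
     (\<forall>z. (F' has_derivative blinfun_apply (F'' z)) (at z)) \<and> continuous_on UNIV F''"
    unfolding twice_continuously_differentiable_def by (elim exE)
  note F'F'' = this
  have F': "((\<lambda>(x, y). F x y) has_derivative blinfun_apply (F' z)) (at z)" for z
    using F'F'' by (elim conjE allE)
  have F'': "(F' has_derivative blinfun_apply (F'' z)) (at z)" for z
    using F'F'' by (elim conjE allE)
  define g where "g s t = F' (s, t) (0, 1) / F s t" for s t
  have "(F s has_real_derivative F' (s, t) (0, 1)) (at t)" for s t
  proof -
    have "((\<lambda>t. (s, t)) has_derivative (\<lambda>h. (0, h))) (at t)"
      by (intro has_derivative_Pair has_derivative_const has_derivative_ident)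
    from has_derivative_compose[OF this F']
    have "(F s has_derivative (\<lambda>h. F' (s, t) (0, h))) (at t)" by simp
    moreover have "F' (s, t) (0, h) = F' (s, t) (0, 1) * h" for h
      using blinfun.scaleR_right[of "F' (s, t)" h "(0, 1)"] by (simp add: mult.commute)
    then have "(\<lambda>h. F' (s, t) (0, h)) = (*) (F' (s, t) (0, 1))"
      by (rule ext)
    ultimately show ?thesis unfolding has_field_derivative_def by (simp only:)
  qed
  then have dln: "((\<lambda>t. ln (F s t)) has_real_derivative g s t) (at t)" for s t
    unfolding g_def using pos by (auto intro!: derivative_eq_intros)
  have dg: "((\<lambda>s. g s t) has_real_derivative mixed_log_derivative F s t) (at s)" for s t
  proof -
    have line: "((\<lambda>s. (s, t)) has_derivative (\<lambda>h. (h, 0))) (at s)"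
      by (intro has_derivative_Pair has_derivative_const has_derivative_ident)
    have "(\<lambda>s. F' (s, t)) differentiable (at s)"
      using has_derivative_compose[OF line F''] by (rule differentiableI)
    then have "(\<lambda>s. F' (s, t) (0, 1)) differentiable (at s)"
      by (rule differentiable_compose[OF bounded_linear_imp_differentiable[OF blinfun.bounded_linear_left]])
    moreover have "(\<lambda>s. F s t) differentiable (at s)"
      using has_derivative_compose[OF line F'] unfolding case_prod_conv by (rule differentiableI)
    moreover have "F s t \<noteq> 0" using pos[rule_format, of s t] by simp
    ultimately have "(\<lambda>s. g s t) differentiable (at s)"
      unfolding g_def by (rule differentiable_divide)
    moreover have "mixed_log_derivative F s t = deriv (\<lambda>s. g s t) s"
      unfolding mixed_log_derivative_def using dln[THEN DERIV_imp_deriv] by simp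
    ultimately show ?thesis
      by (simp add: DERIV_deriv_iff_real_differentiable)
  qed
  have "k * g x2 t < k * g x1 t" for t
    using less(1)
  proof (rule DERIV_neg_imp_decreasing)
    show "\<exists>d. ((\<lambda>s. k * g s t) has_real_derivative d) (at s) \<and> d < 0" for s
      by (intro exI conjI, rule DERIV_cmult[OF dg]) (simp add: sgn)
  qed
  then have neg: "k * (g x2 t - g x1 t) < 0" for t by (simp add: algebra_simps)
  have "k * (ln (F x2 y2) - ln (F x1 y2)) < k * (ln (F x2 y1) - ln (F x1 y1))"
    using less(2)
  proof (rule DERIV_neg_imp_decreasing)
    show "\<exists>d. ((\<lambda>t. k * (ln (F x2 t) - ln (F x1 t))) has_real_derivative d) (at t) \<and> d < 0" for t
      by (intro exI conjI, rule DERIV_cmult[OF DERIV_diff[OF dln dln]]) (rule neg)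
  qed
  then show ?thesis by (simp add: algebra_simps)
qed

text \<open>Multiplying the two exchange inequalities cancels the weights \<open>w\<^sub>1\<close> and \<open>w\<^sub>2\<close>, and reverses the inequality
when they are negative. What is left compares \<open>F(x\<^sub>1, y\<^sub>1) F(x\<^sub>2, y\<^sub>2)\<close> with \<open>F(x\<^sub>1, y\<^sub>2) F(x\<^sub>2, y\<^sub>1)\<close>,
and the rectangle inequality decides the order of \<open>y\<^sub>1\<close> and \<open>y\<^sub>2\<close>. The sign \<open>k\<close> opposite to the mixed derivative and the sign
\<open>l\<close> of the weights enter through their product only.\<close>
lemma ordered_by_exchange_inequalities:
  fixes F :: "real \<Rightarrow> real \<Rightarrow> real"
  assumes pos: "\<forall>x y. 0 < F x y"
    and C2: "twice_continuously_differentiable (\<lambda>(x, y). F x y)"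
    and sgn: "\<forall>x y. k * mixed_log_derivative F x y < 0"
    and signs: "k \<in> {1, -1}" "l \<in> {1, -1}" "0 < l * w1" "0 < l * w2"
    and "x1 < x2"
    and ex: "w1 * F x1 y1 \<le> w2 * F x2 y1" "w2 * F x2 y2 \<le> w1 * F x1 y2"
  shows "k * l * y1 \<le> k * l * y2"
proof (rule ccontr)
  assume not_le: "\<not> k * l * y1 \<le> k * l * y2"
  have rect: "y1 < y2 \<Longrightarrow> k * (ln (F x1 y1) + ln (F x2 y2)) < k * (ln (F x1 y2) + ln (F x2 y1))"
    "y2 < y1 \<Longrightarrow> k * (ln (F x1 y2) + ln (F x2 y1)) < k * (ln (F x1 y1) + ln (F x2 y2))"
    using ln_rectangle_inequality[OF pos C2 sgn \<open>x1 < x2\<close>] by auto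
  have *: "ln (F x1 y1) + ln (F x2 y2) \<le> ln (F x1 y2) + ln (F x2 y1)"
    if "0 < a" "0 < b" "a * F x1 y1 \<le> b * F x2 y1" "b * F x2 y2 \<le> a * F x1 y2" for a b
  proof -
    have "ln (a * F x1 y1) \<le> ln (b * F x2 y1)" "ln (b * F x2 y2) \<le> ln (a * F x1 y2)"
      using that pos by (auto intro!: ln_mono)
    then show ?thesis using that pos by (simp add: ln_mult_pos)
  qed
  have **: "ln (F x1 y1) + ln (F x2 y2) \<ge> ln (F x1 y2) + ln (F x2 y1)"
    if "0 < a" "0 < b" "a * F x1 y1 \<ge> b * F x2 y1" "b * F x2 y2 \<ge> a * F x1 y2" for a b
  proof -
    have "ln (a * F x1 y1) \<ge> ln (b * F x2 y1)" "ln (b * F x2 y2) \<ge> ln (a * F x1 y2)"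
      using that pos by (auto intro!: ln_mono)
    then show ?thesis using that pos by (simp add: ln_mult_pos)
  qed
  from signs(2) consider "l = 1" | "l = -1" by blast
  then show False
  proof cases
    case 1
    then show False using *[of w1 w2] rect signs not_le ex by auto
  next
    case 2
    then show False using **[of "- w1" "- w2"] rect signs not_le ex by auto
  qed
qed

section \<open>Monotone relations and right-continuous maps\<close>

text \<open>The map is the infimum of all values that the relation takes strictly to the right of \<open>x\<close>. Looking
strictly to the right makes it right-continuous, and monotonicity of the relation places every related
\<open>y\<close> between the left limit and the value of the map at \<open>x\<close>. So the relation agrees with the map except
at the countably many jumps.\<close>
lemma monotone_relation_graph:
  fixes R :: "(real \<times> real) set"
  assumes Y: "compact Y" "Y \<noteq> {}" "R \<subseteq> UNIV \<times> Y"
    and R: "\<And>x y x' y'. (x, y) \<in> R \<Longrightarrow> (x', y') \<in> R \<Longrightarrow> x < x' \<Longrightarrow> y \<le> y'"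
  obtains T where "\<And>x. T x \<in> Y" "mono T" "\<And>x. continuous (at x within {x..}) T"
    "countable {x. \<exists>y. (x, y) \<in> R \<and> y \<noteq> T x}"
proof -
  \<comment> \<open>The greatest element of \<open>Y\<close> is the value at points with nothing related to their right.\<close>
  define D where "D x = insert (Sup Y) {y. \<exists>t>x. (t, y) \<in> R}" for x
  define T where "T x = Inf (D x)" for x
  have "bdd_above Y" "bdd_below Y" "closed Y"
    using compact_imp_bounded[OF Y(1)] compact_imp_closed[OF Y(1)]
    by (auto intro: bounded_imp_bdd_above bounded_imp_bdd_below)
  have Sup_mem: "Sup Y \<in> Y"
    using Y(2) \<open>bdd_above Y\<close> \<open>closed Y\<close> by (rule closed_contains_Sup)
  have Sup_upper: "y \<le> Sup Y" if "y \<in> Y" for y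
    using that \<open>bdd_above Y\<close> by (rule cSup_upper)
  have DY: "D x \<subseteq> Y" "D x \<noteq> {}" for x
    using Y(3) Sup_mem by (auto simp: D_def)
  have bdd: "bdd_below (D x)" for x
    using \<open>bdd_below Y\<close> DY(1) by (rule bdd_below_mono)
  have T_le: "T x \<le> y" if "y \<in> D x" for x y
    unfolding T_def using that bdd by (rule cInf_lower)
  have TY: "T x \<in> Y" for x
    unfolding T_def using \<open>closed Y\<close> bdd DY by (intro closed_subset_contains_Inf)
  have "D x' \<subseteq> D x" if "x \<le> x'" for x x'
  proof
    fix y assume "y \<in> D x'"
    then consider "y = Sup Y" | t where "x' < t" "(t, y) \<in> R" by (auto simp: D_def)
    then show "y \<in> D x"
    proof cases
      case 2
      then have "x < t" using that by simp
      with 2 show ?thesis by (auto simp: D_def)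
    qed (simp add: D_def)
  qed
  then have mono: "mono T"
    unfolding T_def by (intro monoI cInf_superset_mono DY bdd)
  have cont: "continuous (at x within {x..}) T" for x
    unfolding continuous_within
  proof (rule order_tendstoI)
    fix a assume "a < T x"
    then have "a < T t" if "x \<le> t" for t
      using monoD[OF mono that] by simp
    then show "\<forall>\<^sub>F t in at x within {x..}. a < T t"
      unfolding eventually_at_filter by (intro always_eventually) simp
  next
    fix a assume "T x < a"
    then obtain y where y: "y \<in> D x" "y < a"
      unfolding T_def using DY(2)[of x] cInf_lessD by blast
    obtain t where t: "x < t" "\<And>s. s < t \<Longrightarrow> y \<in> D s"
    proof (cases "y = Sup Y")
      case True
      then show ?thesis using that[of "x + 1"] by (simp add: D_def)
    next
      case False
      with y(1) obtain t where "x < t" "(t, y) \<in> R" by (auto simp: D_def)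
      then show ?thesis using that[of t] by (auto simp: D_def)
    qed
    have "\<forall>\<^sub>F s in at x within {x..}. s < t"
      by (rule order_tendstoD(2)[OF tendsto_ident_at t(1)])
    then show "\<forall>\<^sub>F s in at x within {x..}. T s < a"
    proof eventually_elim
      case (elim s)
      then have "T s \<le> y" by (intro T_le t(2))
      with y(2) show ?case by simp
    qed
  qed
  have "{x. \<exists>y. (x, y) \<in> R \<and> y \<noteq> T x} \<subseteq> {x. \<not> isCont T x}"
  proof safe
    fix x y assume xy: "(x, y) \<in> R" "isCont T x" "y \<noteq> T x"
    have "y \<le> z" if "z \<in> D x" for z
    proof (cases "z = Sup Y")
      case True
      then show ?thesis using xy(1) Y(3) Sup_upper by auto
    next
      case False
      with that obtain t where "x < t" "(t, z) \<in> R" by (auto simp: D_def)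
      then show ?thesis using R[OF xy(1)] by blast
    qed
    then have "y \<le> T x"
      unfolding T_def using DY(2) by (intro cInf_greatest)
    moreover have "T x \<le> y"
    proof (rule tendsto_upperbound)
      show "(T \<longlongrightarrow> T x) (at_left x)"
        using xy(2) by (simp add: isCont_def filterlim_at_split)
      have "T t \<le> y" if "t < x" for t
        using xy(1) that by (intro T_le) (auto simp: D_def)
      then show "\<forall>\<^sub>F t in at_left x. T t \<le> y"
        unfolding eventually_at_filter by (intro always_eventually) simp
    qed simp
    ultimately show False using xy(3) by simp
  qed
  then have "countable {x. \<exists>y. (x, y) \<in> R \<and> y \<noteq> T x}"
    using mono_ctble_discont[OF mono] by (rule countable_subset)
  from that[OF TY mono cont this] show ?thesis .
qed

text \<open>For \<open>s = -1\<close> the target is reflected, which turns a decreasing relation into an increasing one and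
preserves right-continuity.\<close>
lemma signed_monotone_relation_graph:
  fixes R :: "(real \<times> real) set"
  assumes Y: "compact Y" "Y \<noteq> {}" "R \<subseteq> UNIV \<times> Y" and s: "s \<in> {1, -1}"
    and R: "\<And>x y x' y'. (x, y) \<in> R \<Longrightarrow> (x', y') \<in> R \<Longrightarrow> x < x' \<Longrightarrow> s * y \<le> s * y'"
  obtains T where "\<And>x. T x \<in> Y" "\<And>x x'. x \<le> x' \<Longrightarrow> s * T x \<le> s * T x'"
    "\<And>x. continuous (at x within {x..}) T" "countable {x. \<exists>y. (x, y) \<in> R \<and> y \<noteq> T x}"
proof -
  have ss: "s * (s * y) = y" for y using s by auto
  obtain T where T: "\<And>x. T x \<in> (*) s ` Y" "mono T" "\<And>x. continuous (at x within {x..}) T"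
    "countable {x. \<exists>y. (x, y) \<in> (\<lambda>(x, y). (x, s * y)) ` R \<and> y \<noteq> T x}"
  proof (rule monotone_relation_graph)
    show "compact ((*) s ` Y)"
      using Y(1) by (intro compact_continuous_image continuous_intros)
    show "(*) s ` Y \<noteq> {}" using Y(2) by simp
    show "(\<lambda>(x, y). (x, s * y)) ` R \<subseteq> UNIV \<times> (*) s ` Y" using Y(3) by auto
  qed (use R in auto)
  show ?thesis
  proof (rule that)
    show "s * T x \<in> Y" for x
    proof -
      from T(1)[of x] obtain y where "y \<in> Y" "T x = s * y" by blast
      then show ?thesis using s by auto
    qed
    show "s * (s * T x) \<le> s * (s * T x')" if "x \<le> x'" for x x'
      using monoD[OF T(2) that] by (simp add: ss)
    show "continuous (at x within {x..}) (\<lambda>x. s * T x)" for x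
      using T(3) by (intro continuous_intros)
    show "countable {x. \<exists>y. (x, y) \<in> R \<and> y \<noteq> s * T x}"
    proof (rule countable_subset[OF _ T(4)], safe)
      fix x y assume "(x, y) \<in> R" "y \<noteq> s * T x"
      then have "(x, s * y) \<in> (\<lambda>(x, y). (x, s * y)) ` R" "s * y \<noteq> T x"
        using ss[of y] by force+
      then show "\<exists>y. (x, y) \<in> (\<lambda>(x, y). (x, s * y)) ` R \<and> y \<noteq> T x" by blast
    qed
  qed
qed

section \<open>Costs of transport kernels\<close>

text \<open>The results up to the first-order condition hold for every sign of \<open>G'\<close> and of the mixed derivative of
\<open>ln F\<close>; the signs are fixed in an extension of this locale.\<close>
locale convex_kernel_transport =
  fixes X Y :: "real set" and \<mu> \<nu> :: "real measure"
    and G :: "real \<Rightarrow> real" and F :: "real \<Rightarrow> real \<Rightarrow> real"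
  assumes compact_X: "compact X" and compact_Y: "compact Y"
    and mu: "\<mu> \<in> prob_measures X" and nu: "\<nu> \<in> prob_measures Y"
    and convex_G: "convex_on {0..} G" and diff_G: "\<forall>u>0. G differentiable (at u)"
    and F_pos: "\<forall>x y. 0 < F x y" and F_C2: "twice_continuously_differentiable (\<lambda>(x, y). F x y)"
begin

lemma sets_mu: "sets \<mu> = sets (restrict_space borel X)" and sets_nu: "sets \<nu> = sets (restrict_space borel Y)"
  using mu nu by (auto simp: prob_measures_def)

lemma space_mu [simp]: "space \<mu> = X" and space_nu [simp]: "space \<nu> = Y"
  using sets_eq_imp_space_eq[OF sets_mu] sets_eq_imp_space_eq[OF sets_nu]
  by (simp_all add: space_restrict_space)

sublocale mu: prob_space \<mu> using mu by (simp add: prob_measures_def)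
sublocale nu: prob_space \<nu> using nu by (simp add: prob_measures_def)

lemma measurable_mu: "borel_measurable (restrict_space borel X) = borel_measurable \<mu>"
  by (intro measurable_cong_sets) (simp_all add: sets_mu)

lemma measurable_ident_mu [measurable]: "(\<lambda>x. x) \<in> \<mu> \<rightarrow>\<^sub>M borel"
  using measurable_ident[of "borel :: real measure"] measurable_restrict_space1[of id borel borel X]
  by (simp add: id_def measurable_cong_sets[OF sets_mu refl])

lemma measurable_ident_nu [measurable]: "(\<lambda>x. x) \<in> \<nu> \<rightarrow>\<^sub>M borel"
  using measurable_ident[of "borel :: real measure"] measurable_restrict_space1[of id borel borel Y]
  by (simp add: id_def measurable_cong_sets[OF sets_nu refl])

lemma finite_measuresD:
  assumes "m \<in> finite_measures Y"
  shows "finite_measure m" "sets m = sets \<nu>" "space m = Y" "borel_measurable m = borel_measurable \<nu>"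
proof -
  show "finite_measure m" and s: "sets m = sets \<nu>"
    using assms by (auto simp: finite_measures_def sets_nu)
  show "space m = Y" using sets_eq_imp_space_eq[OF s] by simp
  show "borel_measurable m = borel_measurable \<nu>" by (intro measurable_cong_sets) (simp_all add: s)
qed

lemma continuous_F: "continuous_on UNIV (\<lambda>(x, y). F x y)"
proof -
  from F_C2 obtain F' F'' where
    "(\<forall>z. ((\<lambda>(x, y). F x y) has_derivative blinfun_apply (F' z)) (at z)) \<and>
     (\<forall>z. (F' has_derivative blinfun_apply (F'' z)) (at z)) \<and> continuous_on UNIV F''"
    unfolding twice_continuously_differentiable_def by (elim exE)
  note F'F'' = this
  have "isCont (\<lambda>(x, y). F x y) z" for z
    by (rule has_derivative_continuous) (use F'F'' in \<open>elim conjE allE\<close>)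
  then show ?thesis
    by (simp add: continuous_on_eq_continuous_at)
qed

lemma F_bounds:
  obtains a b where "0 < a" "\<And>x y. x \<in> X \<Longrightarrow> y \<in> Y \<Longrightarrow> a \<le> F x y"
    "\<And>x y. x \<in> X \<Longrightarrow> y \<in> Y \<Longrightarrow> F x y \<le> b" "0 < b"
proof -
  have ne: "X \<times> Y \<noteq> {}" using mu.not_empty nu.not_empty by simp
  have cpt: "compact (X \<times> Y)" using compact_X compact_Y by (rule compact_Times)
  have cont: "continuous_on (X \<times> Y) (\<lambda>(x, y). F x y)" by (rule continuous_on_subset[OF continuous_F]) simp
  obtain z where z: "z \<in> X \<times> Y" "\<forall>w\<in>X \<times> Y. (\<lambda>(x, y). F x y) z \<le> (\<lambda>(x, y). F x y) w"
    using continuous_attains_inf[OF cpt ne cont] by blast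
  obtain z' where z': "z' \<in> X \<times> Y" "\<forall>w\<in>X \<times> Y. (\<lambda>(x, y). F x y) w \<le> (\<lambda>(x, y). F x y) z'"
    using continuous_attains_sup[OF cpt ne cont] by blast
  show ?thesis
    by (rule that[of "F (fst z) (snd z)" "F (fst z') (snd z')"]) (use z z' F_pos in \<open>auto simp: case_prod_beta\<close>)
qed

lemma measurable_F [measurable]: "(\<lambda>(x, y). F x y) \<in> borel_measurable (\<mu> \<Otimes>\<^sub>M \<nu>)"
proof -
  have "(\<lambda>(x, y). F x y) \<in> borel_measurable (borel \<Otimes>\<^sub>M borel)"
    using borel_measurable_continuous_onI[OF continuous_F] by (simp add: borel_prod)
  moreover have "(\<lambda>z. (fst z, snd z)) \<in> \<mu> \<Otimes>\<^sub>M \<nu> \<rightarrow>\<^sub>M borel \<Otimes>\<^sub>M borel"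
    by (intro measurable_Pair measurable_compose[OF measurable_fst] measurable_compose[OF measurable_snd]
        measurable_ident_mu measurable_ident_nu)
  ultimately show ?thesis
    using measurable_compose by fastforce
qed

lemma measurable_F2: "F x \<in> borel_measurable \<nu>"
proof -
  have "continuous_on UNIV (\<lambda>y. (\<lambda>(x, y). F x y) (x, y))"
    by (intro continuous_on_compose2[OF continuous_F] continuous_intros) auto
  then have "F x \<in> borel_measurable borel"
    using borel_measurable_continuous_onI by simp
  from measurable_compose[OF measurable_ident_nu this] show ?thesis .
qed

text \<open>The argument of \<open>G\<close> in the cost, so that the cost of \<open>q\<close> at \<open>x\<close> is \<open>G (action q x)\<close>. Since \<open>F\<close> is
bounded above and away from zero on \<open>X \<times> Y\<close>, it is comparable with the total mass of \<open>q\<^sup>x\<close>.\<close>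
definition action :: "(real \<Rightarrow> real measure) \<Rightarrow> real \<Rightarrow> real" where
  "action q x = (\<integral>y. F x y \<partial>q x)"

lemma integrable_F:
  assumes "m \<in> finite_measures Y" "x \<in> X"
  shows "integrable m (F x)"
proof -
  interpret finite_measure m using assms(1) by (rule finite_measuresD)
  obtain b where "\<And>y. y \<in> Y \<Longrightarrow> F x y \<le> b" using F_bounds assms(2) by metis
  then show ?thesis
    using F_pos finite_measuresD[OF assms(1)] measurable_F2
    by (intro integrable_const_bound[where B = b]) (auto simp: less_imp_le)
qed

lemma kernelD:
  assumes "q \<in> transport_kernels \<mu> \<nu>" 
  shows "\<And>x. x \<in> X \<Longrightarrow> q x \<in> finite_measures Y"
    and "\<And>A. A \<in> sets \<nu> \<Longrightarrow> (\<lambda>x. emeasure (q x) A) \<in> borel_measurable \<mu>"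
    and "\<And>A. A \<in> sets \<nu> \<Longrightarrow> (\<integral>\<^sup>+x. emeasure (q x) A \<partial>\<mu>) = emeasure \<nu> A"
  using assms by (auto simp: transport_kernels_def nonneg_kernel_def measurable_mu sets_nu)

lemma kernelI:
  assumes "\<And>x. x \<in> X \<Longrightarrow> q x \<in> finite_measures Y"
    and "\<And>A. A \<in> sets \<nu> \<Longrightarrow> (\<lambda>x. emeasure (q x) A) \<in> borel_measurable \<mu>"
    and "\<And>A. A \<in> sets \<nu> \<Longrightarrow> (\<integral>\<^sup>+x. emeasure (q x) A \<partial>\<mu>) = emeasure \<nu> A"
  shows "q \<in> transport_kernels \<mu> \<nu>"
  using assms by (auto simp: transport_kernels_def nonneg_kernel_def measurable_mu sets_nu[symmetric])

lemma measurable_kernel_nn_integral: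
  assumes "q \<in> transport_kernels \<mu> \<nu>" "case_prod f \<in> borel_measurable (\<mu> \<Otimes>\<^sub>M \<nu>)"
  shows "(\<lambda>x. \<integral>\<^sup>+y. f x y \<partial>q x) \<in> borel_measurable \<mu>"
  using assms kernelD[OF assms(1)] finite_measuresD
  by (intro measurable_nn_integral_finite_kernel[where N = \<nu>]) auto

lemma ennreal_action:
  assumes "q \<in> transport_kernels \<mu> \<nu>" "x \<in> X"
  shows "ennreal (action q x) = (\<integral>\<^sup>+y. ennreal (F x y) \<partial>q x)"
  unfolding action_def
  using nn_integral_eq_integral[OF integrable_F[OF kernelD(1)[OF assms] assms(2)]] F_pos
  by (simp add: less_imp_le)

lemma action_nonneg: "0 \<le> action q x"
  unfolding action_def using F_pos by (intro Bochner_Integration.integral_nonneg) (simp add: less_imp_le)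

lemma measurable_action:
  assumes "q \<in> transport_kernels \<mu> \<nu>"
  shows "action q \<in> borel_measurable \<mu>"
proof -
  have "(\<lambda>x. enn2real (\<integral>\<^sup>+y. ennreal (F x y) \<partial>q x)) \<in> borel_measurable \<mu>"
    using measurable_kernel_nn_integral[OF assms, of "\<lambda>x y. ennreal (F x y)"] by measurable
  then show ?thesis
    by (rule measurable_cong[THEN iffD1, rotated])
      (simp add: ennreal_action[OF assms, symmetric] action_nonneg)
qed

lemma action_pos_iff:
  assumes "q \<in> transport_kernels \<mu> \<nu>" "x \<in> X"
  shows "0 < action q x \<longleftrightarrow> 0 < emeasure (q x) Y"
proof -
  note m = finite_measuresD[OF kernelD(1)[OF assms]]
  have F: "F x \<in> borel_measurable (q x)" using m measurable_F2 by simp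
  have "action q x = 0 \<longleftrightarrow> (\<integral>\<^sup>+y. ennreal (F x y) \<partial>q x) = 0"
    using ennreal_action[OF assms] action_nonneg[of q x] by (metis ennreal_0 ennreal_eq_0_iff order_antisym)
  also have "\<dots> \<longleftrightarrow> (AE y in q x. ennreal (F x y) = 0)"
    using F by (intro nn_integral_0_iff_AE) auto
  also have "\<dots> \<longleftrightarrow> (AE y in q x. False)"
    using F_pos by (intro AE_cong) (simp add: ennreal_eq_0_iff not_le)
  also have "\<dots> \<longleftrightarrow> emeasure (q x) Y = 0"
    using m(3) by (metis AE_iff_measurable[of "space (q x)" "q x" "\<lambda>_. False"] sets.top mem_Collect_eq Collect_cong Collect_mem_eq)
  finally show ?thesis
    using action_nonneg[of q x] by (auto simp: zero_less_iff_neq_zero less_le)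
qed

lemma integrable_action:
  assumes q: "q \<in> transport_kernels \<mu> \<nu>"
  shows "integrable \<mu> (action q)"
proof (rule integrableI_bounded)
  obtain b where b: "\<And>x y. x \<in> X \<Longrightarrow> y \<in> Y \<Longrightarrow> F x y \<le> b" "0 < b" using F_bounds by metis
  have "(\<integral>\<^sup>+x. ennreal (norm (action q x)) \<partial>\<mu>) \<le> (\<integral>\<^sup>+x. ennreal b * emeasure (q x) Y \<partial>\<mu>)"
  proof (rule nn_integral_mono)
    fix x assume "x \<in> space \<mu>"
    then have x: "x \<in> X" and m: "q x \<in> finite_measures Y" using kernelD[OF q] by auto
    have "ennreal (norm (action q x)) = (\<integral>\<^sup>+y. ennreal (F x y) \<partial>q x)"
      using ennreal_action[OF q x] action_nonneg[of q x] by simp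
    also have "\<dots> \<le> (\<integral>\<^sup>+y. ennreal b \<partial>q x)"
      using b x finite_measuresD(3)[OF m] by (intro nn_integral_mono ennreal_leI) auto
    finally show "ennreal (norm (action q x)) \<le> ennreal b * emeasure (q x) Y"
      using finite_measuresD(3)[OF m] by simp
  qed
  also have "\<dots> = ennreal b * (\<integral>\<^sup>+x. emeasure (q x) Y \<partial>\<mu>)"
    using kernelD(2)[OF q, of Y] sets.top[of \<nu>] by (intro nn_integral_cmult) simp
  also have "\<dots> < \<infinity>"
    using kernelD(3)[OF q, of Y] sets.top[of \<nu>] nu.emeasure_space_1 by (simp add: ennreal_mult_less_top)
  finally show "(\<integral>\<^sup>+x. ennreal (norm (action q x)) \<partial>\<mu>) < \<infinity>" .
qed (rule measurable_action[OF q])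

text \<open>\<open>G\<close> is continuous on the open half-line, and its value at 0 is treated separately.\<close>
lemma measurable_G_action:
  assumes "q \<in> transport_kernels \<mu> \<nu>"
  shows "(\<lambda>x. G (action q x)) \<in> borel_measurable \<mu>"
proof -
  have "continuous_on {0<..} G"
    using diff_G by (intro continuous_at_imp_continuous_on) (auto intro: differentiable_imp_continuous_within)
  then have "(\<lambda>u. indicator {0<..} u *\<^sub>R G u) \<in> borel_measurable borel"
    by (intro borel_measurable_continuous_on_indicator) auto
  then have "(\<lambda>u. if 0 < u then indicator {0<..} u *\<^sub>R G u else G 0) \<in> borel_measurable borel"
    by measurable
  from measurable_compose[OF measurable_action[OF assms] this] show ?thesis
  proof (rule measurable_cong[THEN iffD1, rotated])
    fix x
    show "(if 0 < action q x then indicator {0<..} (action q x) *\<^sub>R G (action q x) else G 0) = G (action q x)"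
      using action_nonneg[of q x] by (cases "action q x = 0") auto
  qed
qed

lemma tangent_G: "0 < v \<Longrightarrow> 0 \<le> u \<Longrightarrow> G v + deriv G v * (u - v) \<le> G u"
  using convex_above_tangent[OF convex_G] diff_G by blast

abbreviation c :: "real \<Rightarrow> real measure \<Rightarrow> real" where
  "c \<equiv> integral_cost G F"

text \<open>The tangent of \<open>G\<close> at 1 bounds the cost from below by an affine function of the action, which is
integrable; an integrable upper bound therefore makes the cost integrable. Competitors are always
controlled in this one-sided way.\<close>
lemma integrable_cost_if_le:
  assumes q: "q \<in> transport_kernels \<mu> \<nu>" and g: "integrable \<mu> g" "\<And>x. x \<in> X \<Longrightarrow> G (action q x) \<le> g x"
  shows "integrable \<mu> (\<lambda>x. G (action q x))"
proof (rule Bochner_Integration.integrable_bound)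
  show "integrable \<mu> (\<lambda>x. \<bar>G 1 + deriv G 1 * (action q x - 1)\<bar> + \<bar>g x\<bar>)"
    using integrable_action[OF q] g(1) by (intro Bochner_Integration.integrable_add integrable_abs integrable_mult_right Bochner_Integration.integrable_diff) auto
  show "AE x in \<mu>. norm (G (action q x)) \<le> norm (\<bar>G 1 + deriv G 1 * (action q x - 1)\<bar> + \<bar>g x\<bar>)"
  proof (rule AE_I2)
    fix x assume "x \<in> space \<mu>"
    then show "norm (G (action q x)) \<le> norm (\<bar>G 1 + deriv G 1 * (action q x - 1)\<bar> + \<bar>g x\<bar>)"
      using g(2)[of x] tangent_G[of 1 "action q x"] action_nonneg[of q x] by auto
  qed
qed (rule measurable_G_action[OF q])

lemma kernel_cost_eq:
  assumes "integrable \<mu> (\<lambda>x. G (action q x))"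
  shows "kernel_cost c \<mu> q = ereal (\<integral>x. G (action q x) \<partial>\<mu>)"
  using enn2ereal_diff_nn_integrals[OF assms] by (simp add: kernel_cost_def integral_cost_def action_def)

text \<open>The positive part must be finite because the subtraction of extended reals returns \<open>\<infinity>\<close> otherwise; the
negative part is finite by the tangent of \<open>G\<close> at 1.\<close>
lemma integrable_cost_if_finite:
  assumes q: "q \<in> transport_kernels \<mu> \<nu>" and fin: "kernel_cost c \<mu> q < \<infinity>"
  shows "integrable \<mu> (\<lambda>x. G (action q x))"
  unfolding real_integrable_def
proof (intro conjI)
  show "(\<lambda>x. G (action q x)) \<in> borel_measurable \<mu>" by (rule measurable_G_action[OF q])
  show "(\<integral>\<^sup>+x. ennreal (G (action q x)) \<partial>\<mu>) \<noteq> \<infinity>"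
    using fin by (auto simp: kernel_cost_def integral_cost_def action_def minus_ereal_def)
  have "integrable \<mu> (\<lambda>x. G 1 + deriv G 1 * (action q x - 1))"
    using integrable_action[OF q] by (intro Bochner_Integration.integrable_add integrable_mult_right Bochner_Integration.integrable_diff) auto
  then have "(\<integral>\<^sup>+x. ennreal (- (G 1 + deriv G 1 * (action q x - 1))) \<partial>\<mu>) < \<infinity>"
    by (auto simp: real_integrable_def less_top)
  moreover have "(\<integral>\<^sup>+x. ennreal (- G (action q x)) \<partial>\<mu>) \<le> (\<integral>\<^sup>+x. ennreal (- (G 1 + deriv G 1 * (action q x - 1))) \<partial>\<mu>)"
  proof (intro nn_integral_mono ennreal_leI)
    fix x
    show "- G (action q x) \<le> - (G 1 + deriv G 1 * (action q x - 1))"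
      using tangent_G[of 1 "action q x"] action_nonneg[of q x] by simp
  qed
  ultimately show "(\<integral>\<^sup>+x. ennreal (- G (action q x)) \<partial>\<mu>) \<noteq> \<infinity>" by auto
qed

lemma constant_kernel: "(\<lambda>_. \<nu>) \<in> transport_kernels \<mu> \<nu>"
proof (rule kernelI)
  show "\<nu> \<in> finite_measures Y"
    using nu prob_space.finite_measure by (auto simp: prob_measures_def finite_measures_def)
  show "(\<integral>\<^sup>+x. emeasure \<nu> A \<partial>\<mu>) = emeasure \<nu> A" for A
    using mu.emeasure_space_1 by simp
qed auto

text \<open>The kernel that is constantly \<open>\<nu>\<close> has its action in a compact interval of positive numbers, on which \<open>G\<close>
is bounded.\<close>
lemma transport_value_finite: "transport_value c \<mu> \<nu> < \<infinity>"
proof -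
  let ?q = "\<lambda>_::real. \<nu>"
  obtain a b where ab: "0 < a" "\<And>x y. x \<in> X \<Longrightarrow> y \<in> Y \<Longrightarrow> a \<le> F x y"
    "\<And>x y. x \<in> X \<Longrightarrow> y \<in> Y \<Longrightarrow> F x y \<le> b" by (rule F_bounds) blast
  have "continuous_on {a..b} G"
    using diff_G ab(1) by (intro continuous_at_imp_continuous_on) (auto intro: differentiable_imp_continuous_within)
  then have "bounded (G ` {a..b})" by (intro compact_imp_bounded compact_continuous_image) auto
  then obtain M where "\<forall>z\<in>G ` {a..b}. norm z \<le> M" unfolding bounded_iff by blast
  then have M: "\<bar>G u\<bar> \<le> M" if "u \<in> {a..b}" for u using that by simp
  have "G (action ?q x) \<le> M" if x: "x \<in> X" for x
  proof -
    have i: "integrable \<nu> (F x)" using integrable_F kernelD(1)[OF constant_kernel] x by blast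
    have "a \<le> action ?q x" "action ?q x \<le> b"
      unfolding action_def using ab(2,3) x i by (auto intro!: nu.integral_ge_const nu.integral_le_const)
    then show ?thesis using M[of "action ?q x"] by auto
  qed
  then have "integrable \<mu> (\<lambda>x. G (action ?q x))"
    using constant_kernel by (intro integrable_cost_if_le[where g = "\<lambda>_. M"]) auto
  then have "kernel_cost c \<mu> ?q < \<infinity>" by (simp add: kernel_cost_eq)
  moreover have "transport_value c \<mu> \<nu> \<le> kernel_cost c \<mu> ?q"
    unfolding transport_value_def using constant_kernel by (rule INF_lower)
  ultimately show ?thesis by (rule le_less_trans[rotated])
qed

abbreviation solution :: "(real \<Rightarrow> real measure) \<Rightarrow> bool" where
  "solution \<equiv> kernel_solution c \<mu> \<nu>"

lemma solution_kernel: "solution q \<Longrightarrow> q \<in> transport_kernels \<mu> \<nu>"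
  by (simp add: kernel_solution_def)

lemma solution_integrable: "solution q \<Longrightarrow> integrable \<mu> (\<lambda>x. G (action q x))"
  using integrable_cost_if_finite transport_value_finite by (simp add: kernel_solution_def)

lemma solution_optimal:
  assumes q: "solution q" and q': "q' \<in> transport_kernels \<mu> \<nu>"
    and i: "integrable \<mu> (\<lambda>x. G (action q' x))"
  shows "(\<integral>x. G (action q x) \<partial>\<mu>) \<le> (\<integral>x. G (action q' x) \<partial>\<mu>)"
proof -
  have "kernel_cost c \<mu> q \<le> kernel_cost c \<mu> q'"
    using q q' by (simp add: kernel_solution_def transport_value_def INF_lower)
  then show ?thesis
    using kernel_cost_eq[OF i] kernel_cost_eq[OF solution_integrable[OF q]] by simp
qed

lemma solution_optimal_bound:
  assumes q: "solution q" and q': "q' \<in> transport_kernels \<mu> \<nu>"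
    and g: "integrable \<mu> g" "\<And>x. x \<in> X \<Longrightarrow> G (action q' x) \<le> g x"
  shows "(\<integral>x. G (action q x) \<partial>\<mu>) \<le> (\<integral>x. g x \<partial>\<mu>)"
proof -
  have i: "integrable \<mu> (\<lambda>x. G (action q' x))" using q' g by (rule integrable_cost_if_le)
  have "(\<integral>x. G (action q' x) \<partial>\<mu>) \<le> (\<integral>x. g x \<partial>\<mu>)" using i g by (intro integral_mono) auto
  with solution_optimal[OF q q' i] show ?thesis by simp
qed

section \<open>Averaging and exchanging mass\<close>

lemma add_measure_finite_measures:
  assumes "m \<in> finite_measures Y" "n \<in> finite_measures Y"
  shows "add_measure m n \<in> finite_measures Y"
proof -
  note mD = finite_measuresD[OF assms(1)] and nD = finite_measuresD[OF assms(2)]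
  have "emeasure m Y \<noteq> \<infinity>" "emeasure n Y \<noteq> \<infinity>"
    using mD(1) nD(1) by (metis finite_measure.emeasure_finite infinity_ennreal_def)+
  moreover have "emeasure (add_measure m n) Y = emeasure m Y + emeasure n Y"
    using mD nD sets.top[of \<nu>] by (intro emeasure_add_measure) auto
  ultimately have "finite_measure (add_measure m n)"
    using mD(3) by (intro finite_measureI) auto
  then show ?thesis using mD(2) by (simp add: finite_measures_def sets_nu)
qed

lemma density_finite_measures:
  assumes m: "m \<in> finite_measures Y" and w: "w \<in> borel_measurable \<nu>" "\<And>y. w y \<le> ennreal b"
  shows "density m w \<in> finite_measures Y"
proof -
  note mD = finite_measuresD[OF m]
  have "emeasure (density m w) Y = (\<integral>\<^sup>+y. w y * indicator Y y \<partial>m)"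
    using w(1) mD sets.top[of m] by (intro emeasure_density) auto
  also have "\<dots> \<le> (\<integral>\<^sup>+y. ennreal b \<partial>m)"
    using w(2) by (intro nn_integral_mono) (auto simp: indicator_def)
  also have "\<dots> = ennreal b * emeasure m Y"
    using mD(3) by simp
  also have "\<dots> < \<infinity>"
    using finite_measure.emeasure_finite[OF mD(1), of Y] by (simp add: ennreal_mult_less_top less_top)
  finally have "finite_measure (density m w)"
    using mD(3) by (intro finite_measureI) auto
  then show ?thesis using mD(2) by (simp add: finite_measures_def sets_nu)
qed

text \<open>The midpoint of two kernels, written with densities so that it is an instance of the same sum of
weighted measures as the exchange below.\<close>
definition average_kernel :: "(real \<Rightarrow> real measure) \<Rightarrow> (real \<Rightarrow> real measure) \<Rightarrow> real \<Rightarrow> real measure" where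
  "average_kernel q1 q2 x = add_measure (density (q1 x) (\<lambda>_. ennreal (1 / 2))) (density (q2 x) (\<lambda>_. ennreal (1 / 2)))"

lemma average_kernel:
  assumes q1: "q1 \<in> transport_kernels \<mu> \<nu>" and q2: "q2 \<in> transport_kernels \<mu> \<nu>"
  shows emeasure_average_kernel: "\<And>x A. x \<in> X \<Longrightarrow> A \<in> sets \<nu> \<Longrightarrow>
      emeasure (average_kernel q1 q2 x) A = ennreal (1 / 2) * emeasure (q1 x) A + ennreal (1 / 2) * emeasure (q2 x) A"
    and average_kernel_in: "average_kernel q1 q2 \<in> transport_kernels \<mu> \<nu>"
    and action_average_kernel: "\<And>x. x \<in> X \<Longrightarrow> action (average_kernel q1 q2) x = (action q1 x + action q2 x) / 2"
proof -
  note D1 = finite_measuresD[OF kernelD(1)[OF q1]] and D2 = finite_measuresD[OF kernelD(1)[OF q2]]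
  have half: "density (q1 x) (\<lambda>_. ennreal (1 / 2)) \<in> finite_measures Y" "density (q2 x) (\<lambda>_. ennreal (1 / 2)) \<in> finite_measures Y"
    if "x \<in> X" for x
    using kernelD(1)[OF q1 that] kernelD(1)[OF q2 that] by (auto intro!: density_finite_measures[where b = "1 / 2"])
  show e: "emeasure (average_kernel q1 q2 x) A = ennreal (1 / 2) * emeasure (q1 x) A + ennreal (1 / 2) * emeasure (q2 x) A"
    if x: "x \<in> X" and A: "A \<in> sets \<nu>" for x A
    using D1[OF x] D2[OF x] A unfolding average_kernel_def
    by (simp add: emeasure_add_measure emeasure_density_const del: ennreal_half)
  show k: "average_kernel q1 q2 \<in> transport_kernels \<mu> \<nu>"
  proof (rule kernelI)
    fix A assume A: "A \<in> sets \<nu>"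
    note [measurable] = kernelD(2)[OF q1 A] kernelD(2)[OF q2 A]
    show "(\<lambda>x. emeasure (average_kernel q1 q2 x) A) \<in> borel_measurable \<mu>"
      using A by (subst measurable_cong[OF e]) (auto simp del: ennreal_half)
    have "(\<integral>\<^sup>+x. emeasure (average_kernel q1 q2 x) A \<partial>\<mu>)
        = (\<integral>\<^sup>+x. ennreal (1 / 2) * emeasure (q1 x) A + ennreal (1 / 2) * emeasure (q2 x) A \<partial>\<mu>)"
      using e A by (intro nn_integral_cong) simp
    also have "\<dots> = ennreal (1 / 2) * emeasure \<nu> A + ennreal (1 / 2) * emeasure \<nu> A"
      using kernelD(3)[OF q1 A] kernelD(3)[OF q2 A] by (simp add: nn_integral_add nn_integral_cmult del: ennreal_half)
    also have "\<dots> = emeasure \<nu> A"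
      by (simp add: distrib_right[symmetric] ennreal_plus[symmetric] del: ennreal_half ennreal_plus)
    finally show "(\<integral>\<^sup>+x. emeasure (average_kernel q1 q2 x) A \<partial>\<mu>) = emeasure \<nu> A" .
  qed (use half in \<open>auto simp: average_kernel_def intro!: add_measure_finite_measures simp del: ennreal_half\<close>)
  show "action (average_kernel q1 q2) x = (action q1 x + action q2 x) / 2" if x: "x \<in> X" for x
  proof -
    have "action (average_kernel q1 q2) x
        = (\<integral>y. F x y \<partial>density (q1 x) (\<lambda>_. ennreal (1 / 2))) + (\<integral>y. F x y \<partial>density (q2 x) (\<lambda>_. ennreal (1 / 2)))"
      unfolding action_def average_kernel_def
      using half[OF x] F_pos integrable_F x D1[OF x] D2[OF x]
      by (intro integral_add_measure) (auto simp: less_imp_le)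
    also have "(\<integral>y. F x y \<partial>density (q1 x) (\<lambda>_. ennreal (1 / 2))) = (\<integral>y. (1 / 2) *\<^sub>R F x y \<partial>q1 x)"
      using measurable_F2 D1[OF x] by (intro integral_density) auto
    also have "(\<integral>y. F x y \<partial>density (q2 x) (\<lambda>_. ennreal (1 / 2))) = (\<integral>y. (1 / 2) *\<^sub>R F x y \<partial>q2 x)"
      using measurable_F2 D2[OF x] by (intro integral_density) auto
    finally show ?thesis by (simp add: action_def)
  qed
qed

lemma G_midpoint: "0 \<le> u \<Longrightarrow> 0 \<le> v \<Longrightarrow> G ((u + v) / 2) \<le> (G u + G v) / 2"
  using convex_onD[OF convex_G, of "1 / 2" u v] by (simp add: field_simps)

text \<open>Convexity bounds the cost of the midpoint by the average of the two equal optimal costs. The equality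
of integrals in the second claim says that the convexity inequality is an equality almost everywhere,
which is what strict convexity needs later.\<close>
lemma solution_average:
  assumes q1: "solution q1" and q2: "solution q2"
  shows "solution (average_kernel q1 q2)"
    and "(\<integral>x. G (action (average_kernel q1 q2) x) \<partial>\<mu>) = (\<integral>x. (G (action q1 x) + G (action q2 x)) / 2 \<partial>\<mu>)"
proof -
  let ?q = "average_kernel q1 q2"
  note k1 = solution_kernel[OF q1] and k2 = solution_kernel[OF q2]
  note k = average_kernel_in[OF k1 k2]
  have i: "integrable \<mu> (\<lambda>x. (G (action q1 x) + G (action q2 x)) / 2)"
    using solution_integrable[OF q1] solution_integrable[OF q2] by simp
  have le: "G (action ?q x) \<le> (G (action q1 x) + G (action q2 x)) / 2" if "x \<in> X" for x
    using G_midpoint action_nonneg by (simp add: action_average_kernel[OF k1 k2 that])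
  have ik: "integrable \<mu> (\<lambda>x. G (action ?q x))" by (rule integrable_cost_if_le[OF k i le])
  have cost: "(\<integral>x. G (action q2 x) \<partial>\<mu>) = (\<integral>x. G (action q1 x) \<partial>\<mu>)"
    using solution_optimal[OF q1 k2 solution_integrable[OF q2]]
      solution_optimal[OF q2 k1 solution_integrable[OF q1]] by simp
  have avg: "(\<integral>x. (G (action q1 x) + G (action q2 x)) / 2 \<partial>\<mu>) = (\<integral>x. G (action q1 x) \<partial>\<mu>)"
    using solution_integrable[OF q1] solution_integrable[OF q2] cost by simp
  have eq: "(\<integral>x. G (action ?q x) \<partial>\<mu>) = (\<integral>x. G (action q1 x) \<partial>\<mu>)"
    using solution_optimal[OF q1 k ik] integral_mono[OF ik i le] avg by simp
  have "kernel_cost c \<mu> ?q = kernel_cost c \<mu> q1"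
    using kernel_cost_eq[OF ik] kernel_cost_eq[OF solution_integrable[OF q1]] eq by simp
  then show "solution ?q" using q1 k by (simp add: kernel_solution_def)
  show "(\<integral>x. G (action ?q x) \<partial>\<mu>) = (\<integral>x. (G (action q1 x) + G (action q2 x)) / 2 \<partial>\<mu>)"
    using eq avg by simp
qed

text \<open>The marginal on \<open>Y\<close> of the part of \<open>\<mu>(dx) q\<^sup>x(dy)\<close> that lies in \<open>A \<times> B\<close>.\<close>
definition moved_mass :: "(real \<Rightarrow> real measure) \<Rightarrow> real set \<Rightarrow> real set \<Rightarrow> real measure" where
  "moved_mass q A B = measure_of Y (sets \<nu>) (\<lambda>C. \<integral>\<^sup>+x. indicator A x * emeasure (q x) (B \<inter> C) \<partial>\<mu>)"

lemma moved_mass: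
  assumes q: "q \<in> transport_kernels \<mu> \<nu>" and A: "A \<in> sets \<mu>" and B: "B \<in> sets \<nu>"
  shows emeasure_moved_mass: "\<And>C. C \<in> sets \<nu> \<Longrightarrow>
      emeasure (moved_mass q A B) C = (\<integral>\<^sup>+x. indicator A x * emeasure (q x) (B \<inter> C) \<partial>\<mu>)"
    and moved_mass_finite: "moved_mass q A B \<in> finite_measures Y"
proof -
  have s: "sets (moved_mass q A B) = sets \<nu>" "space (moved_mass q A B) = Y"
    unfolding moved_mass_def
    using sets.sigma_sets_eq[of \<nu>] sets.space_closed[of \<nu>] by simp_all
  show e: "emeasure (moved_mass q A B) C = (\<integral>\<^sup>+x. indicator A x * emeasure (q x) (B \<inter> C) \<partial>\<mu>)"
    if "C \<in> sets \<nu>" for C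
    unfolding moved_mass_def
  proof (rule emeasure_measure_of_sigma)
    show "sigma_algebra Y (sets \<nu>)" using sets.sigma_algebra_axioms[of \<nu>] by simp
    show "positive (sets \<nu>) (\<lambda>C. \<integral>\<^sup>+x. indicator A x * emeasure (q x) (B \<inter> C) \<partial>\<mu>)"
      by (simp add: positive_def)
    show "countably_additive (sets \<nu>) (\<lambda>C. \<integral>\<^sup>+x. indicator A x * emeasure (q x) (B \<inter> C) \<partial>\<mu>)"
      unfolding countably_additive_def
    proof (intro allI impI)
      fix D :: "nat \<Rightarrow> real set"
      assume D: "range D \<subseteq> sets \<nu>" "disjoint_family D" "\<Union> (range D) \<in> sets \<nu>"
      then have BD: "B \<inter> D i \<in> sets \<nu>" for i using B by auto
      have disj: "disjoint_family (\<lambda>i. B \<inter> D i)"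
        using D(2) unfolding disjoint_family_on_def by blast
      have "(\<Sum>i. \<integral>\<^sup>+x. indicator A x * emeasure (q x) (B \<inter> D i) \<partial>\<mu>)
          = (\<integral>\<^sup>+x. (\<Sum>i. indicator A x * emeasure (q x) (B \<inter> D i)) \<partial>\<mu>)"
        using kernelD(2)[OF q BD] A by (intro nn_integral_suminf[symmetric]) auto
      also have "\<dots> = (\<integral>\<^sup>+x. indicator A x * emeasure (q x) (B \<inter> \<Union> (range D)) \<partial>\<mu>)"
      proof (rule nn_integral_cong)
        fix x assume "x \<in> space \<mu>"
        then have "sets (q x) = sets \<nu>" using finite_measuresD(2)[OF kernelD(1)[OF q]] by simp
        then have "(\<Sum>i. emeasure (q x) (B \<inter> D i)) = emeasure (q x) (\<Union>i. B \<inter> D i)"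
          using BD disj by (intro suminf_emeasure) auto
        then show "(\<Sum>i. indicator A x * emeasure (q x) (B \<inter> D i)) = indicator A x * emeasure (q x) (B \<inter> \<Union> (range D))"
          by simp
      qed
      finally show "(\<Sum>i. \<integral>\<^sup>+x. indicator A x * emeasure (q x) (B \<inter> D i) \<partial>\<mu>)
          = (\<integral>\<^sup>+x. indicator A x * emeasure (q x) (B \<inter> \<Union> (range D)) \<partial>\<mu>)" .
    qed
  qed fact
  have "emeasure (moved_mass q A B) Y \<le> (\<integral>\<^sup>+x. emeasure (q x) Y \<partial>\<mu>)"
  proof (subst e)
    show "Y \<in> sets \<nu>" using sets.top[of \<nu>] by simp
    show "(\<integral>\<^sup>+x. indicator A x * emeasure (q x) (B \<inter> Y) \<partial>\<mu>) \<le> (\<integral>\<^sup>+x. emeasure (q x) Y \<partial>\<mu>)"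
    proof (rule nn_integral_mono)
      fix x assume "x \<in> space \<mu>"
      then have "sets (q x) = sets \<nu>" using finite_measuresD(2)[OF kernelD(1)[OF q]] by simp
      then have "emeasure (q x) (B \<inter> Y) \<le> emeasure (q x) Y"
        using B sets.top[of \<nu>] by (intro emeasure_mono) auto
      then show "indicator A x * emeasure (q x) (B \<inter> Y) \<le> emeasure (q x) Y"
        by (simp add: indicator_def)
    qed
  qed
  also have "\<dots> = 1"
    using kernelD(3)[OF q, of Y] sets.top[of \<nu>] nu.emeasure_space_1 by simp
  also have "\<dots> < \<infinity>" by simp
  finally have "finite_measure (moved_mass q A B)"
    using s by (intro finite_measureI) auto
  then show "moved_mass q A B \<in> finite_measures Y"
    using s by (simp add: finite_measures_def sets_nu)
qed

text \<open>The fraction \<open>e\<close> of the mass in \<open>A1 \<times> B\<close> is removed and spread evenly over the base points in \<open>A2\<close>, in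
proportion to the removed marginal. Both operations act on the marginal on \<open>Y\<close> by the same measure, so the
result transports \<open>\<mu>\<close> to \<open>\<nu>\<close> again.\<close>
definition exchange_kernel ::
    "(real \<Rightarrow> real measure) \<Rightarrow> real set \<Rightarrow> real set \<Rightarrow> real set \<Rightarrow> real \<Rightarrow> real \<Rightarrow> real measure" where
  "exchange_kernel q A1 A2 B e x = add_measure
     (density (q x) (\<lambda>y. ennreal (1 - e * indicator A1 x * indicator B y)))
     (density (moved_mass q A1 B) (\<lambda>_. ennreal (e / measure \<mu> A2 * indicator A2 x)))"

lemma exchange_kernel:
  assumes q: "q \<in> transport_kernels \<mu> \<nu>"
    and A1 [measurable]: "A1 \<in> sets \<mu>" and A2 [measurable]: "A2 \<in> sets \<mu>" and B [measurable]: "B \<in> sets \<nu>"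
    and e: "0 \<le> e" "e \<le> 1" and pos: "0 < measure \<mu> A2"
  shows exchange_kernel_in: "exchange_kernel q A1 A2 B e \<in> transport_kernels \<mu> \<nu>"
    and action_exchange_kernel: "\<And>x. x \<in> X \<Longrightarrow> action (exchange_kernel q A1 A2 B e) x =
      action q x - e * indicator A1 x * (\<integral>y. indicator B y * F x y \<partial>q x)
      + e / measure \<mu> A2 * indicator A2 x * (\<integral>y. F x y \<partial>moved_mass q A1 B)"
proof -
  let ?q = "exchange_kernel q A1 A2 B e" and ?r = "moved_mass q A1 B"
  let ?d = "\<lambda>x y. 1 - e * indicator A1 x * indicator B y :: real"
  let ?t = "\<lambda>x. e / measure \<mu> A2 * indicator A2 x :: real"
  have d: "0 \<le> ?d x y" "?d x y \<le> 1" for x y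
    using e by (auto simp: indicator_def)
  have t: "0 \<le> ?t x" "?t x \<le> e / measure \<mu> A2" for x
    using e pos by (auto simp: indicator_def)
  note D = finite_measuresD[OF kernelD(1)[OF q]]
  note R = finite_measuresD[OF moved_mass_finite[OF q A1 B]]
  have fin1: "density (q x) (\<lambda>y. ennreal (?d x y)) \<in> finite_measures Y" if "x \<in> X" for x
    using kernelD(1)[OF q that] d by (intro density_finite_measures[where b = 1]) (auto intro: ennreal_leI)
  have fin2: "density ?r (\<lambda>_. ennreal (?t x)) \<in> finite_measures Y" for x
    using moved_mass_finite[OF q A1 B] t by (intro density_finite_measures[where b = "e / measure \<mu> A2"]) (auto intro: ennreal_leI)
  have em: "emeasure (?q x) C = (\<integral>\<^sup>+y. ennreal (?d x y) * indicator C y \<partial>q x) + ennreal (?t x) * emeasure ?r C"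
    if x: "x \<in> X" and C: "C \<in> sets \<nu>" for x C
    unfolding exchange_kernel_def using D[OF x] R C
    by (simp add: emeasure_add_measure emeasure_density_const emeasure_density)
  have meas_d: "(\<lambda>x. \<integral>\<^sup>+y. ennreal (?d x y) * indicator C y \<partial>q x) \<in> borel_measurable \<mu>"
    if [measurable]: "C \<in> sets \<nu>" for C
    by (rule measurable_kernel_nn_integral[OF q]) measurable
  show "?q \<in> transport_kernels \<mu> \<nu>"
  proof (rule kernelI)
    show "?q x \<in> finite_measures Y" if "x \<in> X" for x
      unfolding exchange_kernel_def by (intro add_measure_finite_measures fin1 fin2 that)
  next
    fix C assume C [measurable]: "C \<in> sets \<nu>"
    have [measurable]: "(\<lambda>x. ennreal (?t x) * emeasure ?r C) \<in> borel_measurable \<mu>"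
      by measurable
    note [measurable] = meas_d[OF C]
    show "(\<lambda>x. emeasure (?q x) C) \<in> borel_measurable \<mu>"
      using C by (subst measurable_cong[OF em]) (auto intro!: borel_measurable_add)
    have BC: "B \<inter> C \<in> sets \<nu>" by simp
    have mBC [measurable]: "(\<lambda>x. indicator A1 x * emeasure (q x) (B \<inter> C)) \<in> borel_measurable \<mu>"
      using kernelD(2)[OF q BC] by measurable
    have "(\<integral>\<^sup>+x. ennreal (?t x) * emeasure ?r C \<partial>\<mu>) = (\<integral>\<^sup>+x. ennreal (e / measure \<mu> A2) * emeasure ?r C * indicator A2 x \<partial>\<mu>)"
      by (intro nn_integral_cong) (auto simp: indicator_def)
    also have "\<dots> = ennreal (e / measure \<mu> A2) * emeasure ?r C * ennreal (measure \<mu> A2)"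
      by (simp add: nn_integral_cmult_indicator mu.emeasure_eq_measure)
    also have "\<dots> = ennreal (e / measure \<mu> A2 * measure \<mu> A2) * emeasure ?r C"
      using e pos by (subst ennreal_mult) (auto simp: ac_simps)
    also have "\<dots> = ennreal e * (\<integral>\<^sup>+x. indicator A1 x * emeasure (q x) (B \<inter> C) \<partial>\<mu>)"
      using pos by (simp add: emeasure_moved_mass[OF q A1 B C])
    also have "\<dots> = (\<integral>\<^sup>+x. ennreal e * (indicator A1 x * emeasure (q x) (B \<inter> C)) \<partial>\<mu>)"
      by (simp add: nn_integral_cmult)
    finally have t_int: "(\<integral>\<^sup>+x. ennreal (?t x) * emeasure ?r C \<partial>\<mu>)
        = (\<integral>\<^sup>+x. ennreal e * (indicator A1 x * emeasure (q x) (B \<inter> C)) \<partial>\<mu>)" .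
    have "(\<integral>\<^sup>+x. emeasure (?q x) C \<partial>\<mu>)
        = (\<integral>\<^sup>+x. (\<integral>\<^sup>+y. ennreal (?d x y) * indicator C y \<partial>q x) + ennreal (?t x) * emeasure ?r C \<partial>\<mu>)"
      using em C by (intro nn_integral_cong) simp
    also have "\<dots> = (\<integral>\<^sup>+x. (\<integral>\<^sup>+y. ennreal (?d x y) * indicator C y \<partial>q x) \<partial>\<mu>) + (\<integral>\<^sup>+x. ennreal (?t x) * emeasure ?r C \<partial>\<mu>)"
      by (intro nn_integral_add) measurable
    also have "\<dots> = (\<integral>\<^sup>+x. (\<integral>\<^sup>+y. ennreal (?d x y) * indicator C y \<partial>q x)
        + ennreal e * (indicator A1 x * emeasure (q x) (B \<inter> C)) \<partial>\<mu>)"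
      unfolding t_int by (intro nn_integral_add[symmetric]) measurable
    also have "\<dots> = (\<integral>\<^sup>+x. emeasure (q x) C \<partial>\<mu>)"
    proof (rule nn_integral_cong)
      fix x assume "x \<in> space \<mu>"
      then have x: "x \<in> X" by simp
      have [measurable]: "B \<in> sets (q x)" "C \<in> sets (q x)" using D(2)[OF x] by auto
      have "ennreal e * (indicator A1 x * emeasure (q x) (B \<inter> C))
          = (\<integral>\<^sup>+y. ennreal (e * indicator A1 x) * indicator (B \<inter> C) y \<partial>q x)"
        by (subst nn_integral_cmult_indicator) (auto simp: indicator_def)
      then have "(\<integral>\<^sup>+y. ennreal (?d x y) * indicator C y \<partial>q x) + ennreal e * (indicator A1 x * emeasure (q x) (B \<inter> C))
          = (\<integral>\<^sup>+y. ennreal (?d x y) * indicator C y + ennreal (e * indicator A1 x) * indicator (B \<inter> C) y \<partial>q x)"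
        by (simp add: nn_integral_add)
      also have "\<dots> = (\<integral>\<^sup>+y. indicator C y \<partial>q x)"
        using e by (intro nn_integral_cong) (auto simp: indicator_def ennreal_plus[symmetric] simp del: ennreal_plus)
      finally show "(\<integral>\<^sup>+y. ennreal (?d x y) * indicator C y \<partial>q x) + ennreal e * (indicator A1 x * emeasure (q x) (B \<inter> C))
          = emeasure (q x) C" by simp
    qed
    also have "\<dots> = emeasure \<nu> C" using kernelD(3)[OF q C] .
    finally show "(\<integral>\<^sup>+x. emeasure (?q x) C \<partial>\<mu>) = emeasure \<nu> C" .
  qed
  show "action ?q x = action q x - e * indicator A1 x * (\<integral>y. indicator B y * F x y \<partial>q x)
      + ?t x * (\<integral>y. F x y \<partial>?r)" if x: "x \<in> X" for x
  proof -
    have F: "F x \<in> borel_measurable (q x)" "F x \<in> borel_measurable ?r" "B \<in> sets (q x)"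
      using measurable_F2 D[OF x] R by auto
    note iF = integrable_F[OF kernelD(1)[OF q x] x]
    have iBF: "integrable (q x) (\<lambda>y. indicator B y * F x y)"
      using integrable_mult_indicator[OF F(3) iF] by simp
    have "action ?q x = (\<integral>y. F x y \<partial>density (q x) (\<lambda>y. ennreal (?d x y))) + (\<integral>y. F x y \<partial>density ?r (\<lambda>_. ennreal (?t x)))"
      unfolding action_def exchange_kernel_def
      using fin1[OF x] fin2 F_pos integrable_F x D[OF x] R
      by (intro integral_add_measure) (auto simp: less_imp_le)
    also have "(\<integral>y. F x y \<partial>density (q x) (\<lambda>y. ennreal (?d x y))) = (\<integral>y. ?d x y *\<^sub>R F x y \<partial>q x)"
      using F d by (intro integral_density) auto
    also have "\<dots> = (\<integral>y. F x y - e * indicator A1 x * (indicator B y * F x y) \<partial>q x)"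
      by (intro Bochner_Integration.integral_cong) (auto simp: algebra_simps)
    also have "\<dots> = action q x - e * indicator A1 x * (\<integral>y. indicator B y * F x y \<partial>q x)"
      unfolding action_def using iF iBF by (subst Bochner_Integration.integral_diff) auto
    also have "(\<integral>y. F x y \<partial>density ?r (\<lambda>_. ennreal (?t x))) = (\<integral>y. ?t x *\<^sub>R F x y \<partial>?r)"
      using F t by (intro integral_density) auto
    finally show ?thesis by simp
  qed
qed

text \<open>The first-order optimality condition, stated for sets of positive measure. On \<open>A1\<close> the
exchange lowers the cost by at least \<open>e a q\<^sup>x(B)\<close>, on \<open>A2\<close> it raises it by at most \<open>e b T / \<mu>(A2)\<close>, where \<open>T\<close>
is the mass in \<open>A1 \<times> B\<close>; integration gives a total change of at most \<open>e T (b - a)\<close>, which optimality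
forbids to be negative. Both local bounds use the tangent of \<open>G\<close> at the new action. This is why the bounds on
\<open>G' F\<close> are required on slightly larger intervals than those containing the old actions, and it avoids any
limit \<open>e \<rightarrow> 0\<close> under the integral.\<close>
lemma exchange_inequality:
  assumes q: "solution q"
    and A1 [measurable]: "A1 \<in> sets \<mu>" and A2 [measurable]: "A2 \<in> sets \<mu>" and B [measurable]: "B \<in> sets \<nu>"
    and disj: "A1 \<inter> A2 = {}" and pos: "0 < emeasure \<mu> A2" "0 < emeasure \<mu> A1"
    and charged: "\<And>x. x \<in> A1 \<Longrightarrow> 0 < emeasure (q x) B"
    and margin: "0 < d" "0 < l1" "0 < l2"
    and act1: "\<And>x. x \<in> A1 \<Longrightarrow> l1 + d \<le> action q x \<and> action q x \<le> h1"
    and act2: "\<And>x. x \<in> A2 \<Longrightarrow> l2 \<le> action q x \<and> action q x \<le> h2 - d"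
    and lower: "\<And>x v y. x \<in> A1 \<Longrightarrow> l1 \<le> v \<Longrightarrow> v \<le> h1 \<Longrightarrow> y \<in> B \<Longrightarrow> a \<le> deriv G v * F x y"
    and upper: "\<And>x v y. x \<in> A2 \<Longrightarrow> l2 \<le> v \<Longrightarrow> v \<le> h2 \<Longrightarrow> y \<in> B \<Longrightarrow> deriv G v * F x y \<le> b"
  shows "a \<le> b"
proof -
  note k = solution_kernel[OF q]
  note D = finite_measuresD[OF kernelD(1)[OF k]]
  let ?r = "moved_mass q A1 B"
  note R = finite_measuresD[OF moved_mass_finite[OF k A1 B]]
  interpret r: finite_measure ?r by (rule R)
  have A1X: "x \<in> X" if "x \<in> A1" for x using sets.sets_into_space[OF A1] that by auto
  have A2X: "x \<in> X" if "x \<in> A2" for x using sets.sets_into_space[OF A2] that by auto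
  have A2_Int: "A2 \<inter> X = A2" using A2X by auto
  have mA2: "0 < measure \<mu> A2" using pos by (simp add: mu.emeasure_eq_measure)
  define m where "m x = measure (q x) B" for x
  define H where "H x = (\<integral>y. indicator B y * F x y \<partial>q x)" for x
  define K where "K x = (\<integral>y. F x y \<partial>?r)" for x
  define T where "T = measure ?r Y"
  have em: "emeasure (q x) B = ennreal (m x)" if "x \<in> X" for x
    using D(1)[OF that] by (simp add: m_def finite_measure.emeasure_eq_measure)
  have T: "ennreal T = (\<integral>\<^sup>+x. indicator A1 x * emeasure (q x) B \<partial>\<mu>)"
  proof -
    have "ennreal T = emeasure ?r Y" by (simp add: T_def r.emeasure_eq_measure)
    also have "\<dots> = (\<integral>\<^sup>+x. indicator A1 x * emeasure (q x) (B \<inter> Y) \<partial>\<mu>)"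
      using sets.top[of \<nu>] by (intro emeasure_moved_mass[OF k A1 B]) simp
    also have "B \<inter> Y = B" using sets.sets_into_space[OF B] by auto
    finally show ?thesis .
  qed
  have [measurable]: "(\<lambda>x. emeasure (q x) B) \<in> borel_measurable \<mu>" by (rule kernelD(2)[OF k B])
  have m_meas [measurable]: "m \<in> borel_measurable \<mu>"
    unfolding m_def measure_def by measurable
  have T_nn: "ennreal T = (\<integral>\<^sup>+x. ennreal (indicator A1 x * m x) \<partial>\<mu>)"
    unfolding T using em by (intro nn_integral_cong) (auto simp: indicator_def)
  have "integrable \<mu> (\<lambda>x. indicator A1 x * m x)" "(\<integral>x. indicator A1 x * m x \<partial>\<mu>) = T"
  proof -
    have nn: "AE x in \<mu>. 0 \<le> indicator A1 x * m x" by (simp add: m_def)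
    show "integrable \<mu> (\<lambda>x. indicator A1 x * m x)"
      using nn T_nn by (intro integrableI_nonneg) (auto simp: T_nn[symmetric])
    show "(\<integral>x. indicator A1 x * m x \<partial>\<mu>) = T"
      using integral_eq_nn_integral[OF _ nn] by (simp add: T_nn[symmetric] T_def)
  qed
  note m_int = this
  have T_pos: "0 < T"
  proof (rule ccontr)
    assume "\<not> 0 < T"
    then have "(\<integral>\<^sup>+x. indicator A1 x * emeasure (q x) B \<partial>\<mu>) = 0"
      using T by (simp add: ennreal_neg)
    then have "AE x in \<mu>. indicator A1 x * emeasure (q x) B = 0"
      by (subst (asm) nn_integral_0_iff_AE) auto
    from exists_in_of_AE[OF pos(2) A1 this] obtain x where "x \<in> A1" "indicator A1 x * emeasure (q x) B = 0"
      by blast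
    then show False using charged[of x] by simp
  qed
  have r_B: "AE y in ?r. y \<in> B"
  proof -
    have "emeasure ?r (Y - B) = (\<integral>\<^sup>+x. indicator A1 x * emeasure (q x) (B \<inter> (Y - B)) \<partial>\<mu>)"
      using sets.top[of \<nu>] by (intro emeasure_moved_mass[OF k A1 B]) auto
    also have "\<dots> = 0" by simp
    finally have "Y - B \<in> null_sets ?r"
      using R(2) sets.top[of \<nu>] by (intro null_setsI) auto
    from AE_not_in[OF this] AE_space show ?thesis
      by eventually_elim (auto simp: R(3))
  qed
  obtain M where M: "0 < M" "\<And>x y. x \<in> X \<Longrightarrow> y \<in> Y \<Longrightarrow> F x y \<le> M" using F_bounds by metis
  have iF: "integrable (q x) (F x)" "integrable ?r (F x)" if "x \<in> X" for x
    using integrable_F[OF kernelD(1)[OF k that] that] integrable_F[OF moved_mass_finite[OF k A1 B] that] by auto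
  have iBF: "integrable (q x) (\<lambda>y. indicator B y * F x y)" if "x \<in> X" for x
    using integrable_mult_indicator[of B "q x", OF _ iF(1)[OF that]] B D(2)[OF that] by simp
  have H: "0 \<le> H x" "H x \<le> action q x" if "x \<in> X" for x
    unfolding H_def action_def using F_pos iBF[OF that] iF[OF that]
    by (auto intro!: Bochner_Integration.integral_nonneg integral_mono simp: less_imp_le indicator_def)
  have K: "0 \<le> K x" "K x \<le> M * T" if "x \<in> X" for x
  proof -
    show "0 \<le> K x" unfolding K_def using F_pos by (intro Bochner_Integration.integral_nonneg) (simp add: less_imp_le)
    have "K x \<le> (\<integral>y. M \<partial>?r)"
      unfolding K_def using iF[OF that] M(2)[OF that] R(3) by (intro integral_mono) auto
    then show "K x \<le> M * T" by (simp add: T_def R(3) mult.commute)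
  qed
  \<comment> \<open>Small enough that the action moves by at most the margin \<open>d\<close> on both sets.\<close>
  define e where "e = min 1 (min (d / (\<bar>h1\<bar> + 1)) (d * measure \<mu> A2 / (M * T)))"
  have e: "0 < e" "e \<le> 1" "e * (\<bar>h1\<bar> + 1) \<le> d" "e * (M * T) \<le> d * measure \<mu> A2"
  proof -
    show "0 < e" using margin mA2 M T_pos by (simp add: e_def)
    show "e \<le> 1" by (simp add: e_def)
    have "e \<le> d / (\<bar>h1\<bar> + 1)" "e \<le> d * measure \<mu> A2 / (M * T)" by (auto simp: e_def)
    then show "e * (\<bar>h1\<bar> + 1) \<le> d" "e * (M * T) \<le> d * measure \<mu> A2"
      using M T_pos by (auto simp: pos_le_divide_eq)
  qed
  let ?q = "exchange_kernel q A1 A2 B e"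
  have kq: "?q \<in> transport_kernels \<mu> \<nu>"
    using e mA2 by (intro exchange_kernel_in[OF k A1 A2 B]) auto
  have act: "action ?q x = action q x - e * indicator A1 x * H x + e / measure \<mu> A2 * indicator A2 x * K x"
    if "x \<in> X" for x
    unfolding H_def K_def using e mA2 that by (intro action_exchange_kernel[OF k A1 A2 B]) auto
  define g where "g x = G (action q x) - e * a * (indicator A1 x * m x) + e * b * T / measure \<mu> A2 * indicator A2 x" for x
  have g_int: "integrable \<mu> g"
    unfolding g_def using solution_integrable[OF q] m_int(1)
    by (intro Bochner_Integration.integrable_add Bochner_Integration.integrable_diff integrable_mult_right) (auto simp: mu.emeasure_eq_measure)
  have "(\<integral>x. g x \<partial>\<mu>) = (\<integral>x. G (action q x) \<partial>\<mu>) - e * a * T + e * b * T / measure \<mu> A2 * measure \<mu> A2"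
    unfolding g_def using solution_integrable[OF q] m_int
    by (subst Bochner_Integration.integral_add Bochner_Integration.integral_diff; simp add: mu.emeasure_eq_measure A2_Int)+
  then have g_val: "(\<integral>x. g x \<partial>\<mu>) = (\<integral>x. G (action q x) \<partial>\<mu>) + e * T * (b - a)"
    using mA2 by (simp add: algebra_simps)
  have "G (action ?q x) \<le> g x" if x: "x \<in> X" for x
  proof -
    consider "x \<in> A1" "x \<notin> A2" | "x \<in> A2" "x \<notin> A1" | "x \<notin> A1" "x \<notin> A2" using disj by blast
    then show ?thesis
    proof cases
      case 1
      define v where "v = action ?q x"
      have v: "v = action q x - e * H x" using act[OF x] 1 by (simp add: v_def)
      have "e * H x \<le> e * (\<bar>h1\<bar> + 1)" using H[OF x] act1[OF 1(1)] e by (intro mult_left_mono) auto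
      then have "e * H x \<le> d" using e(3) by (rule order_trans)
      moreover have "0 \<le> e * H x" using e H[OF x] by simp
      ultimately
      have range: "l1 \<le> v" "v \<le> h1" using v act1[OF 1(1)] by linarith+
      have "a * m x = (\<integral>y. indicator B y * a \<partial>q x)"
        using B D(2,3)[OF x] sets.sets_into_space[OF B] by (simp add: m_def Int_absorb2)
      also have "\<dots> \<le> (\<integral>y. deriv G v * (indicator B y * F x y) \<partial>q x)"
        using lower[OF 1(1) range] iBF[OF x] B D(2)[OF x] finite_measure.emeasure_finite[OF D(1)[OF x], of B]
        by (intro integral_mono integrable_mult_right integrable_mult_left integrable_real_indicator)
          (auto simp: indicator_def less_top)
      also have "\<dots> = deriv G v * H x" by (simp add: H_def)
      finally have "e * (a * m x) \<le> e * (deriv G v * H x)" using e by simp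
      moreover have "G v + deriv G v * (e * H x) \<le> G (action q x)"
        using tangent_G[of v "action q x"] range margin v action_nonneg[of q x] by simp
      ultimately show ?thesis using 1 by (simp add: g_def v_def[symmetric] algebra_simps)
    next
      case 2
      define v where "v = action ?q x"
      define t where "t = e / measure \<mu> A2 * K x"
      have v: "v = action q x + t" using act[OF x] 2 by (simp add: v_def t_def)
      have "t \<le> e / measure \<mu> A2 * (M * T)" unfolding t_def using K[OF x] e mA2 by (intro mult_left_mono) auto
      also have "\<dots> \<le> d" using e mA2 by (simp add: field_simps)
      finally have t: "0 \<le> t" "t \<le> d" using K[OF x] e mA2 by (auto simp: t_def)
      then have range: "l2 \<le> v" "v \<le> h2" using v act2[OF 2(1)] by auto
      have "deriv G v * K x = (\<integral>y. deriv G v * F x y \<partial>?r)" by (simp add: K_def)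
      also have "\<dots> \<le> (\<integral>y. b \<partial>?r)"
        using iF[OF x] by (intro integral_mono_AE) (use r_B upper[OF 2(1) range] in \<open>auto elim!: eventually_mono\<close>)
      also have "\<dots> = b * T" by (simp add: T_def R(3) mult.commute)
      finally have "e / measure \<mu> A2 * (deriv G v * K x) \<le> e / measure \<mu> A2 * (b * T)"
        using e mA2 by (intro mult_left_mono) auto
      moreover have "G v + deriv G v * (- t) \<le> G (action q x)"
        using tangent_G[of v "action q x"] range margin v action_nonneg[of q x] by simp
      ultimately show ?thesis using 2 by (simp add: g_def v_def[symmetric] t_def algebra_simps)
    next
      case 3
      then show ?thesis using act[OF x] by (simp add: g_def)
    qed
  qed
  from solution_optimal_bound[OF q kq g_int this] g_val
  have "0 \<le> (e * T) * (b - a)" by simp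
  moreover have "0 < e * T" using e(1) T_pos by simp
  ultimately show ?thesis using mult_pos_neg[of "e * T" "b - a"] by linarith
qed

section \<open>The first-order condition at typical points\<close>

text \<open>The action is one of the coordinates, because the exchange inequality localises in the base point, in
the action and in the target at the same time.\<close>
definition charged_set :: "(real \<Rightarrow> real measure) \<Rightarrow> (real \<times> real \<times> real) set \<Rightarrow> real set" where
  "charged_set q W = {x \<in> X. 0 < emeasure (q x) {y \<in> Y. (x, action q x, y) \<in> W}}"

text \<open>Typical points play the part of density points: whatever open set of triples \<open>q\<close> charges over a typical
point, it charges over a set of base points of positive measure, where mass can be exchanged.\<close>
definition typical :: "(real \<Rightarrow> real measure) \<Rightarrow> real \<Rightarrow> bool" where
  "typical q x \<longleftrightarrow> (\<forall>W. open W \<longrightarrow> x \<in> charged_set q W \<longrightarrow> 0 < emeasure \<mu> (charged_set q W))"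

lemma slice_sets:
  assumes "open W"
  shows "{y \<in> Y. (x, v, y) \<in> W} \<in> sets \<nu>"
proof -
  have "continuous_on UNIV (\<lambda>y. (x, v, y))" by (intro continuous_intros)
  then have "open ((\<lambda>y. (x, v, y)) -` W)" by (rule open_vimage[OF assms])
  then have "Y \<inter> (\<lambda>y. (x, v, y)) -` W \<in> sets \<nu>"
    unfolding sets_nu sets_restrict_space by (intro imageI borel_open)
  also have "Y \<inter> (\<lambda>y. (x, v, y)) -` W = {y \<in> Y. (x, v, y) \<in> W}" by blast
  finally show ?thesis .
qed

lemma charged_set_measurable:
  assumes q: "q \<in> transport_kernels \<mu> \<nu>" and W: "open W"
  shows "charged_set q W \<in> sets \<mu>"
proof -
  have "(\<lambda>z. (fst z, action q (fst z), snd z)) \<in> \<mu> \<Otimes>\<^sub>M \<nu> \<rightarrow>\<^sub>M borel \<Otimes>\<^sub>M borel \<Otimes>\<^sub>M borel"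
    by (intro measurable_Pair measurable_compose[OF measurable_fst] measurable_compose[OF measurable_snd]
        measurable_ident_mu measurable_ident_nu measurable_action[OF q])
  moreover have "W \<in> sets (borel \<Otimes>\<^sub>M borel \<Otimes>\<^sub>M borel)" using W by (simp only: borel_prod borel_open)
  ultimately have "(\<lambda>z. indicator W (fst z, action q (fst z), snd z) :: ennreal) \<in> borel_measurable (\<mu> \<Otimes>\<^sub>M \<nu>)"
    by (intro measurable_compose[OF _ borel_measurable_indicator])
  then have meas: "(\<lambda>x. \<integral>\<^sup>+y. indicator W (x, action q x, y) \<partial>q x) \<in> borel_measurable \<mu>"
    by (intro measurable_kernel_nn_integral[OF q]) (simp add: case_prod_beta')
  have "(\<integral>\<^sup>+y. indicator W (x, action q x, y) \<partial>q x) = emeasure (q x) {y \<in> Y. (x, action q x, y) \<in> W}"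
    if "x \<in> X" for x
  proof -
    note D = finite_measuresD[OF kernelD(1)[OF q that]]
    have "(\<integral>\<^sup>+y. indicator W (x, action q x, y) \<partial>q x) = (\<integral>\<^sup>+y. indicator {y \<in> Y. (x, action q x, y) \<in> W} y \<partial>q x)"
      using D(3) by (intro nn_integral_cong) (auto simp: indicator_def)
    then show ?thesis using slice_sets[OF W] D(2) by simp
  qed
  then have "charged_set q W = {x \<in> space \<mu>. 0 < (\<integral>\<^sup>+y. indicator W (x, action q x, y) \<partial>q x)}"
    by (auto simp: charged_set_def)
  also have "\<dots> \<in> sets \<mu>" using meas by measurable
  finally show ?thesis .
qed

lemma AE_typical:
  assumes q: "q \<in> transport_kernels \<mu> \<nu>"
  shows "AE x in \<mu>. typical q x"
  unfolding typical_def
proof (rule AE_union_preserving_family_pos)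
  note D = finite_measuresD[OF kernelD(1)[OF q]]
  fix \<C> :: "(real \<times> real \<times> real) set set" assume \<C>: "countable \<C>" "\<And>W. W \<in> \<C> \<Longrightarrow> open W"
  show "charged_set q (\<Union>\<C>) \<subseteq> \<Union>(charged_set q ` \<C>)"
  proof
    fix x assume "x \<in> charged_set q (\<Union>\<C>)"
    then have x: "x \<in> X" and pos: "0 < emeasure (q x) {y \<in> Y. (x, action q x, y) \<in> \<Union>\<C>}"
      by (auto simp: charged_set_def)
    show "x \<in> \<Union>(charged_set q ` \<C>)"
    proof (rule ccontr)
      assume "\<not> ?thesis"
      then have "{y \<in> Y. (x, action q x, y) \<in> W} \<in> null_sets (q x)" if "W \<in> \<C>" for W
        using x that slice_sets[OF \<C>(2)[OF that]] D(2)[OF x]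
        by (intro null_setsI) (auto simp: charged_set_def not_gr_zero)
      then have "(\<Union>W\<in>\<C>. {y \<in> Y. (x, action q x, y) \<in> W}) \<in> null_sets (q x)"
        by (rule null_sets_UN'[OF \<C>(1)])
      also have "(\<Union>W\<in>\<C>. {y \<in> Y. (x, action q x, y) \<in> W}) = {y \<in> Y. (x, action q x, y) \<in> \<Union>\<C>}" by auto
      finally show False using pos by (simp add: null_sets_def)
    qed
  qed
next
  note D = finite_measuresD[OF kernelD(1)[OF q]]
  fix W W' :: "(real \<times> real \<times> real) set" assume W: "open W" "open W'" "W \<subseteq> W'"
  show "charged_set q W \<subseteq> charged_set q W'"
  proof
    fix x assume x: "x \<in> charged_set q W"
    then have "emeasure (q x) {y \<in> Y. (x, action q x, y) \<in> W} \<le> emeasure (q x) {y \<in> Y. (x, action q x, y) \<in> W'}"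
      using W(3) slice_sets[OF W(2)] D(2)[of x] by (intro emeasure_mono) (auto simp: charged_set_def)
    with x show "x \<in> charged_set q W'" by (auto simp: charged_set_def)
  qed
qed (rule charged_set_measurable[OF q])

lemma charged_setI:
  assumes q: "q \<in> transport_kernels \<mu> \<nu>" and x: "x \<in> X" and y: "y \<in> measure_support (q x)"
    and W: "open W" "(x, action q x, y) \<in> W"
  shows "x \<in> charged_set q W"
proof -
  let ?V = "(\<lambda>y. (x, action q x, y)) -` W"
  have "continuous_on UNIV (\<lambda>y. (x, action q x, y))" by (intro continuous_intros)
  then have "open ?V" by (rule open_vimage[OF W(1)])
  moreover have "y \<in> ?V" using W(2) by simp
  ultimately have "0 < emeasure (q x) (?V \<inter> space (q x))"
    using y unfolding measure_support_def by blast
  moreover have "?V \<inter> space (q x) = {y \<in> Y. (x, action q x, y) \<in> W}"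
    unfolding finite_measuresD(3)[OF kernelD(1)[OF q x]] by blast
  ultimately show ?thesis using x by (simp add: charged_set_def)
qed

lemma charged_setE:
  assumes "x \<in> charged_set q W"
  obtains y where "(x, action q x, y) \<in> W"
proof -
  have "{y \<in> Y. (x, action q x, y) \<in> W} \<noteq> {}"
  proof
    assume "{y \<in> Y. (x, action q x, y) \<in> W} = {}"
    with assms show False unfolding charged_set_def by simp
  qed
  with that show thesis by blast
qed

lemma action_pos_if_support:
  assumes q: "q \<in> transport_kernels \<mu> \<nu>" and x: "x \<in> X" and y: "y \<in> measure_support (q x)"
  shows "0 < action q x"
proof -
  have "x \<in> charged_set q UNIV" by (rule charged_setI[OF q x y]) auto
  then show ?thesis using action_pos_iff[OF q x] by (simp add: charged_set_def)
qed

text \<open>The marginal cost \<open>G'(v) F(x, y)\<close> of adding mass at \<open>y\<close> over \<open>x\<close> is jointly continuous for \<open>v > 0\<close>.\<close>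
lemma marginal_density_near:
  assumes v: "0 < v" and S: "open S" "deriv G v * F x y \<in> S"
  shows "\<exists>e>0. \<forall>x' v' y'. \<bar>x' - x\<bar> < e \<longrightarrow> \<bar>v' - v\<bar> < e \<longrightarrow> \<bar>y' - y\<bar> < e \<longrightarrow> deriv G v' * F x' y' \<in> S"
proof -
  have "isCont (deriv G) v" using isCont_deriv_convex[OF convex_G diff_G v] .
  moreover have "isCont (\<lambda>(x, y). F x y) (x, y)"
    using continuous_F by (simp add: continuous_on_eq_continuous_at)
  ultimately have "isCont (\<lambda>(x, v, y). deriv G v * (\<lambda>(x, y). F x y) (x, y)) (x, v, y)"
    unfolding case_prod_beta'
    by (intro continuous_mult isCont_o2[where g = "deriv G" and f = "\<lambda>z. fst (snd z)"]
        isCont_o2[where g = "\<lambda>z. F (fst z) (snd z)" and f = "\<lambda>z. (fst z, snd (snd z))"]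
        continuous_intros) auto
  then have "((\<lambda>(x, v, y). deriv G v * (\<lambda>(x, y). F x y) (x, y)) \<longlongrightarrow> deriv G v * F x y) (nhds (x, v, y))"
    unfolding isCont_def tendsto_at_iff_tendsto_nhds by simp
  from topological_tendstoD[OF this S]
  have "\<forall>\<^sub>F z in nhds (x, v, y). (\<lambda>(x, v, y). deriv G v * (\<lambda>(x, y). F x y) (x, y)) z \<in> S" .
  then obtain r where r: "0 < r"
    "\<And>x' v' y'. dist (x', v', y') (x, v, y) < r \<Longrightarrow> deriv G v' * F x' y' \<in> S"
    unfolding eventually_nhds_metric by auto
  show ?thesis
  proof (intro exI[of _ "r / 3"] conjI allI impI)
    fix x' v' y' assume *: "\<bar>x' - x\<bar> < r / 3" "\<bar>v' - v\<bar> < r / 3" "\<bar>y' - y\<bar> < r / 3"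
    have "dist (x', v', y') (x, v, y) \<le> dist x' x + dist (v', y') (v, y)"
      unfolding dist_Pair_Pair[of x'] by (rule sqrt_sum_squares_le_sum) auto
    also have "dist (v', y') (v, y) \<le> dist v' v + dist y' y"
      unfolding dist_Pair_Pair by (rule sqrt_sum_squares_le_sum) auto
    finally show "deriv G v' * F x' y' \<in> S"
      using * by (intro r(2)) (simp add: dist_real_def)
  qed (use r in simp)
qed

text \<open>If the marginal cost of \<open>y\<^sub>1\<close> were larger over \<open>x\<^sub>1\<close> than over \<open>x\<^sub>2\<close>, it would be so by a definite gap on
neighbourhoods of \<open>(x\<^sub>1, action q x\<^sub>1, y\<^sub>1)\<close> and \<open>(x\<^sub>2, action q x\<^sub>2, y\<^sub>1)\<close>. Typicality supplies base points of
positive measure in both, and the exchange inequality is violated. The point \<open>y\<^sub>2\<close> only certifies that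
\<open>q\<close> does not vanish at \<open>x\<^sub>2\<close>, so that \<open>G'\<close> is taken at a positive argument.\<close>
lemma first_order_condition:
  assumes q: "solution q" and x: "x1 \<in> X" "x2 \<in> X" "x1 \<noteq> x2" and typi: "typical q x1" "typical q x2"
    and y1: "y1 \<in> measure_support (q x1)" and y2: "y2 \<in> measure_support (q x2)"
  shows "deriv G (action q x1) * F x1 y1 \<le> deriv G (action q x2) * F x2 y1"
proof (rule ccontr)
  assume "\<not> ?thesis"
  then obtain a b where ab: "deriv G (action q x2) * F x2 y1 < b" "b < a" "a < deriv G (action q x1) * F x1 y1"
    by (meson dense not_le)
  note k = solution_kernel[OF q]
  note D = finite_measuresD[OF kernelD(1)[OF k]]
  define u1 u2 where "u1 = action q x1" and "u2 = action q x2"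
  have u: "0 < u1" "0 < u2" using action_pos_if_support[OF k] x y1 y2 by (auto simp: u1_def u2_def)
  obtain e1 where e1: "0 < e1"
    "\<And>x' v' y'. \<bar>x' - x1\<bar> < e1 \<Longrightarrow> \<bar>v' - u1\<bar> < e1 \<Longrightarrow> \<bar>y' - y1\<bar> < e1 \<Longrightarrow> a < deriv G v' * F x' y'"
    using marginal_density_near[OF u(1), of "{a<..}" x1 y1] ab by (auto simp: u1_def)
  obtain e2 where e2: "0 < e2"
    "\<And>x' v' y'. \<bar>x' - x2\<bar> < e2 \<Longrightarrow> \<bar>v' - u2\<bar> < e2 \<Longrightarrow> \<bar>y' - y1\<bar> < e2 \<Longrightarrow> deriv G v' * F x' y' < b"
    using marginal_density_near[OF u(2), of "{..<b}" x2 y1] ab by (auto simp: u2_def)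
  \<comment> \<open>The bounds \<open>u1\<close> and \<open>u2\<close> keep the actions positive, the last bound makes the neighbourhoods of \<open>x1\<close> and \<open>x2\<close> disjoint.\<close>
  define e where "e = Min {e1, e2, u1, u2, \<bar>x1 - x2\<bar> / 2}"
  have e: "0 < e" "e \<le> e1" "e \<le> e2" "e \<le> u1" "e \<le> u2" "e \<le> \<bar>x1 - x2\<bar> / 2"
  proof -
    show "0 < e" using e1(1) e2(1) u x(3) by (simp add: e_def)
    show "e \<le> e1" "e \<le> e2" "e \<le> u1" "e \<le> u2" "e \<le> \<bar>x1 - x2\<bar> / 2"
      unfolding e_def by (rule Min_le; simp)+
  qed
  define W1 where "W1 = ball x1 e \<times> ball u1 (e / 2) \<times> ball y1 e"
  \<comment> \<open>No restriction on the target: at \<open>x2\<close> mass near \<open>y1\<close> is added and none is removed.\<close>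
  define W2 where "W2 = ball x2 e \<times> ball u2 (e / 2) \<times> (UNIV :: real set)"
  have W: "open W1" "open W2" by (auto simp: W1_def W2_def intro!: open_Times)
  define B where "B = {y \<in> Y. \<bar>y - y1\<bar> < e}"
  have B: "B \<in> sets \<nu>"
    using slice_sets[OF W(1), of x1 u1] e by (simp add: W1_def B_def dist_real_def abs_minus_commute)
  have A1: "\<bar>x - x1\<bar> < e" "\<bar>action q x - u1\<bar> < e / 2" "0 < emeasure (q x) B" if "x \<in> charged_set q W1" for x
  proof -
    show c: "\<bar>x - x1\<bar> < e" "\<bar>action q x - u1\<bar> < e / 2"
      using charged_setE[OF that] by (auto simp: W1_def dist_real_def abs_minus_commute)
    then have "{y \<in> Y. (x, action q x, y) \<in> W1} = B"
      by (auto simp: W1_def B_def dist_real_def abs_minus_commute)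
    then show "0 < emeasure (q x) B" using that by (simp add: charged_set_def)
  qed
  have A2: "\<bar>x - x2\<bar> < e" "\<bar>action q x - u2\<bar> < e / 2" if "x \<in> charged_set q W2" for x
  proof -
    show "\<bar>x - x2\<bar> < e" "\<bar>action q x - u2\<bar> < e / 2"
      using charged_setE[OF that] by (auto simp: W2_def dist_real_def abs_minus_commute)
  qed
  have "x1 \<in> charged_set q W1" using e by (intro charged_setI[OF k x(1) y1 W(1)]) (simp add: W1_def u1_def)
  then have pos1: "0 < emeasure \<mu> (charged_set q W1)" using typi(1) W by (simp add: typical_def)
  have "x2 \<in> charged_set q W2" using e by (intro charged_setI[OF k x(2) y2 W(2)]) (simp add: W2_def u2_def)
  then have pos2: "0 < emeasure \<mu> (charged_set q W2)" using typi(2) W by (simp add: typical_def)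
  have "a \<le> b"
  proof (rule exchange_inequality[OF q charged_set_measurable[OF k W(1)] charged_set_measurable[OF k W(2)] B _ pos2 pos1])
    show "charged_set q W1 \<inter> charged_set q W2 = {}"
    proof (rule ccontr)
      assume "charged_set q W1 \<inter> charged_set q W2 \<noteq> {}"
      then obtain x where x: "x \<in> charged_set q W1" "x \<in> charged_set q W2" by blast
      have "\<bar>x1 - x2\<bar> \<le> \<bar>x - x2\<bar> + \<bar>x - x1\<bar>"
        using abs_triangle_ineq4[of "x - x2" "x - x1"] by simp
      then show False using A1(1)[OF x(1)] A2(1)[OF x(2)] e(6) by simp
    qed
    show "0 < emeasure (q x) B" if "x \<in> charged_set q W1" for x using A1(3)[OF that] .
    show "0 < e / 4" "0 < u1 - 3 / 4 * e" "0 < u2 - e / 2" using e by auto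
    show "u1 - 3 / 4 * e + e / 4 \<le> action q x \<and> action q x \<le> u1 + e / 2" if "x \<in> charged_set q W1" for x
      using A1(2)[OF that] by linarith
    show "u2 - e / 2 \<le> action q x \<and> action q x \<le> (u2 + 3 / 4 * e) - e / 4" if "x \<in> charged_set q W2" for x
      using A2(2)[OF that] by linarith
    show "a \<le> deriv G v * F x y" if "x \<in> charged_set q W1" "u1 - 3 / 4 * e \<le> v" "v \<le> u1 + e / 2" "y \<in> B" for x v y
      using e1(2)[of x v y] A1(1)[OF that(1)] that(2-4) e by (auto simp: B_def abs_less_iff)
    show "deriv G v * F x y \<le> b" if "x \<in> charged_set q W2" "u2 - e / 2 \<le> v" "v \<le> u2 + 3 / 4 * e" "y \<in> B" for x v y
      using e2(2)[of x v y] A2(1)[OF that(1)] that(2-4) e by (auto simp: B_def abs_less_iff)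
  qed
  with ab show False by simp
qed

end

section \<open>Monotonicity, representation and uniqueness\<close>

text \<open>All sign patterns at once: \<open>k\<close> is opposite to the sign of the mixed derivative, \<open>l\<close> is the sign of \<open>G'\<close>, and the
product \<open>s\<close> is 1 when the solutions are increasing and -1 when they are decreasing.\<close>
locale signed_convex_kernel_transport = convex_kernel_transport +
  fixes k l s :: real
  assumes k: "k \<in> {1, -1}" and l: "l \<in> {1, -1}" and s: "s = k * l"
    and mixed_sign: "\<forall>x y. k * mixed_log_derivative F x y < 0"
    and deriv_sign: "\<forall>u>0. 0 < l * deriv G u"
begin

lemma typical_supports_ordered:
  assumes q: "solution q" and x: "x1 \<in> X" "x2 \<in> X" "x1 < x2" and typi: "typical q x1" "typical q x2"
    and y1: "y1 \<in> measure_support (q x1)" and y2: "y2 \<in> measure_support (q x2)"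
  shows "s * y1 \<le> s * y2"
proof -
  note kq = solution_kernel[OF q]
  have "x1 \<noteq> x2" "x2 \<noteq> x1" using x(3) by auto
  show ?thesis
    unfolding s
  proof (rule ordered_by_exchange_inequalities[OF F_pos F_C2 mixed_sign k l _ _ x(3)])
    show "0 < l * deriv G (action q x1)" "0 < l * deriv G (action q x2)"
      using deriv_sign action_pos_if_support[OF kq x(1) y1] action_pos_if_support[OF kq x(2) y2] by auto
    show "deriv G (action q x1) * F x1 y1 \<le> deriv G (action q x2) * F x2 y1"
      by (rule first_order_condition[OF q x(1,2) \<open>x1 \<noteq> x2\<close> typi y1 y2])
    show "deriv G (action q x2) * F x2 y2 \<le> deriv G (action q x1) * F x1 y2"
      by (rule first_order_condition[OF q x(2,1) \<open>x2 \<noteq> x1\<close> typi(2,1) y2 y1])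
  qed
qed

text \<open>The midpoint of the two solutions is itself a solution and carries the supports of both. Typicality of
\<open>x\<^sub>1\<close> and \<open>x\<^sub>2\<close> moves the comparison to nearby points that are typical for the midpoint, without making
the exceptional null set of one solution depend on the other.\<close>
lemma two_solutions_ordered:
  assumes q1: "solution q1" and q2: "solution q2" and x: "x1 \<in> X" "x2 \<in> X" "x1 < x2"
    and typi: "typical q1 x1" "typical q2 x2"
    and y1: "y1 \<in> measure_support (q1 x1)" and y2: "y2 \<in> measure_support (q2 x2)"
  shows "s * y1 \<le> s * y2"
proof (rule ccontr)
  assume "\<not> s * y1 \<le> s * y2"
  then have "s * y2 < s * y1" by simp
  from dense[OF this] obtain m where m: "s * y2 < m" "m < s * y1" by blast
  from dense[OF x(3)] obtain z where z: "x1 < z" "z < x2" by blast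
  note k1 = solution_kernel[OF q1] and k2 = solution_kernel[OF q2]
  let ?q = "average_kernel q1 q2"
  have sol: "solution ?q" by (rule solution_average[OF q1 q2])
  note kq = solution_kernel[OF sol]
  have op: "open {y. m < s * y}" "open {y. s * y < m}"
    by (intro open_Collect_less continuous_intros)+
  have ev: "AE x in \<mu>. typical ?q x" by (rule AE_typical[OF kq])
  have meet: "\<exists>y\<in>measure_support (?q x). y \<in> V"
    if x: "x \<in> X" and V: "open V" and pos: "0 < emeasure (q1 x) (V \<inter> Y) \<or> 0 < emeasure (q2 x) (V \<inter> Y)" for x V
  proof -
    note D = finite_measuresD[OF kernelD(1)[OF kq x]]
    have V': "V \<inter> Y \<in> sets \<nu>" unfolding sets_nu sets_restrict_space using V by auto
    have "0 < emeasure (?q x) (V \<inter> Y)"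
      using pos by (auto simp: emeasure_average_kernel[OF k1 k2 x V'] zero_less_iff_neq_zero)
    moreover have "V \<inter> Y \<in> sets (?q x)" using V' D(2) by simp
    moreover have "AE y in ?q x. y \<in> measure_support (?q x)"
      using D(2) by (intro AE_in_measure_support[where Y = Y]) (simp add: sets_nu)
    ultimately have "\<exists>y\<in>V \<inter> Y. y \<in> measure_support (?q x)" by (rule exists_in_of_AE)
    then show ?thesis by blast
  qed
  \<comment> \<open>Separating base points at \<open>z\<close> and targets at \<open>m\<close> keeps both strict orders after moving.\<close>
  define W1 where "W1 = {..<z} \<times> (UNIV :: real set) \<times> {y. m < s * y}"
  define W2 where "W2 = {z<..} \<times> (UNIV :: real set) \<times> {y. s * y < m}"
  have W: "open W1" "open W2" using op by (auto simp: W1_def W2_def intro!: open_Times)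
  have "x1 \<in> charged_set q1 W1" by (rule charged_setI[OF k1 x(1) y1 W(1)]) (use m z in \<open>simp add: W1_def\<close>)
  then have "0 < emeasure \<mu> (charged_set q1 W1)" using typi(1) W unfolding typical_def by blast
  from exists_in_of_AE[OF this charged_set_measurable[OF k1 W(1)] ev]
  obtain t1 where t1: "t1 \<in> charged_set q1 W1" "typical ?q t1" by blast
  have "x2 \<in> charged_set q2 W2" by (rule charged_setI[OF k2 x(2) y2 W(2)]) (use m z in \<open>simp add: W2_def\<close>)
  then have "0 < emeasure \<mu> (charged_set q2 W2)" using typi(2) W unfolding typical_def by blast
  from exists_in_of_AE[OF this charged_set_measurable[OF k2 W(2)] ev]
  obtain t2 where t2: "t2 \<in> charged_set q2 W2" "typical ?q t2" by blast
  have tX: "t1 \<in> X" "t2 \<in> X" using t1 t2 by (auto simp: charged_set_def)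
  have t1z: "t1 < z" using charged_setE[OF t1(1)] by (auto simp: W1_def)
  have t2z: "z < t2" using charged_setE[OF t2(1)] by (auto simp: W2_def)
  have "{y \<in> Y. (t1, action q1 t1, y) \<in> W1} = {y. m < s * y} \<inter> Y" using t1z by (auto simp: W1_def)
  then have "0 < emeasure (q1 t1) ({y. m < s * y} \<inter> Y)" using t1 by (simp add: charged_set_def)
  then obtain v1 where v1: "v1 \<in> measure_support (?q t1)" "m < s * v1" using meet[OF tX(1) op(1)] by blast
  have "{y \<in> Y. (t2, action q2 t2, y) \<in> W2} = {y. s * y < m} \<inter> Y" using t2z by (auto simp: W2_def)
  then have "0 < emeasure (q2 t2) ({y. s * y < m} \<inter> Y)" using t2 by (simp add: charged_set_def)
  then obtain v2 where v2: "v2 \<in> measure_support (?q t2)" "s * v2 < m" using meet[OF tX(2) op(2)] by blast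
  have "t1 < t2" using t1z t2z by simp
  from typical_supports_ordered[OF sol tX this t1(2) t2(2) v1(1) v2(1)] v1(2) v2(2) show False by simp
qed

abbreviation le :: "real \<Rightarrow> real \<Rightarrow> bool" where "le a b \<equiv> s * a \<le> s * b"

lemma supports_ordered_solution:
  assumes q: "solution q"
  shows "supports_ordered le \<mu> q"
proof -
  from AE_typical[OF solution_kernel[OF q]] obtain N where
    N: "{x \<in> space \<mu>. \<not> typical q x} \<subseteq> N" "emeasure \<mu> N = 0" "N \<in> sets \<mu>"
    by (rule AE_E)
  have "emeasure \<mu> (space \<mu> - N) = 1"
    using N(2,3) mu.emeasure_space_1 sets.top[of \<mu>] by (subst emeasure_Diff_null_set) auto
  moreover have "space \<mu> - N \<in> sets \<mu>" using N(3) by blast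
  moreover have "s * y1 \<le> s * y2"
    if "x1 \<in> space \<mu> - N" "x2 \<in> space \<mu> - N" "x1 < x2" "y1 \<in> measure_support (q x1)" "y2 \<in> measure_support (q x2)"
    for x1 x2 y1 y2
  proof (rule typical_supports_ordered[OF q _ _ that(3) _ _ that(4,5)])
    show "x1 \<in> X" "x2 \<in> X" using that(1,2) by auto
    show "typical q x1" "typical q x2" using that(1,2) N(1) by blast+
  qed
  ultimately show ?thesis unfolding supports_ordered_def by blast
qed

text \<open>A kernel whose support has at most one point is the total mass times a Dirac measure.\<close>
lemma represents_kernelI:
  assumes q: "q \<in> transport_kernels \<mu> \<nu>" and T: "\<And>x. T x \<in> Y"
    and supp: "AE x in \<mu>. measure_support (q x) \<subseteq> {T x}"
  shows "represents_kernel \<mu> \<nu> T (\<lambda>x. measure (q x) Y) q"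
  unfolding represents_kernel_def
proof (intro conjI)
  have Y: "Y \<in> sets \<nu>" using sets.top[of \<nu>] by simp
  have [measurable]: "(\<lambda>x. emeasure (q x) Y) \<in> borel_measurable \<mu>" by (rule kernelD(2)[OF q Y])
  show "(\<lambda>x. measure (q x) Y) \<in> borel_measurable \<mu>" unfolding measure_def by measurable
  have em: "ennreal (measure (q x) Y) = emeasure (q x) Y" if "x \<in> X" for x
    using finite_measuresD(1)[OF kernelD(1)[OF q that]] by (simp add: finite_measure.emeasure_eq_measure)
  have "(\<integral>\<^sup>+x. ennreal (measure (q x) Y) \<partial>\<mu>) = (\<integral>\<^sup>+x. emeasure (q x) Y \<partial>\<mu>)"
    using em by (intro nn_integral_cong) simp
  also have "\<dots> = 1" using kernelD(3)[OF q Y] nu.emeasure_space_1 by simp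
  finally show "(\<integral>\<^sup>+x. ennreal (measure (q x) Y) \<partial>\<mu>) = 1" .
  show "AE x in \<mu>. q x = scale_measure (ennreal (measure (q x) Y)) (return (restrict_space borel (space \<nu>)) (T x))"
    using supp AE_space
  proof eventually_elim
    case (elim x)
    then have x: "x \<in> X" by simp
    note D = finite_measuresD[OF kernelD(1)[OF q x]]
    have "AE y in q x. y \<in> measure_support (q x)"
      using D(2) by (intro AE_in_measure_support[where Y = Y]) (simp add: sets_nu)
    then have at: "AE y in q x. y = T x" by eventually_elim (use elim in blast)
    show ?case
    proof (rule measure_eqI)
      show "sets (q x) = sets (scale_measure (ennreal (measure (q x) Y)) (return (restrict_space borel (space \<nu>)) (T x)))"
        using D(2) by (simp add: sets_nu)
      fix A assume A: "A \<in> sets (q x)"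
      then have A': "A \<in> sets (restrict_space borel Y)" using D(2) by (simp add: sets_nu)
      have "emeasure (q x) A = emeasure (q x) (if T x \<in> A then Y else {})"
        using A Y D(2) T by (intro emeasure_eq_AE) (use at in \<open>auto elim!: eventually_mono\<close>)
      also have "\<dots> = ennreal (measure (q x) Y) * indicator A (T x)"
        using em[OF x] by (simp add: indicator_def)
      finally show "emeasure (q x) A
          = emeasure (scale_measure (ennreal (measure (q x) Y)) (return (restrict_space borel (space \<nu>)) (T x))) A"
        using A' by simp
    qed
  qed
qed simp

text \<open>By comparison of solutions in pairs, all points \<open>(x, y)\<close> with \<open>x\<close> typical for some solution and \<open>y\<close> in its
support there form a single monotone relation. The map read off from it serves every solution at once;
the countable exceptional set is null since \<open>\<mu>\<close> has no atoms.\<close>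
lemma solution_map_exists:
  assumes atomless: "\<forall>x\<in>X. emeasure \<mu> {x} = 0"
  obtains T where "solution_map le c \<mu> \<nu> T"
proof -
  define R where "R = {(x, y). \<exists>q. solution q \<and> x \<in> X \<and> typical q x \<and> y \<in> measure_support (q x)}"
  have "Y \<noteq> {}" using nu.not_empty by simp
  moreover have "R \<subseteq> UNIV \<times> Y"
  proof
    fix p assume "p \<in> R"
    then obtain q x y where p: "p = (x, y)" "solution q" "x \<in> X" "y \<in> measure_support (q x)"
      by (auto simp: R_def)
    then show "p \<in> UNIV \<times> Y"
      using finite_measuresD(3)[OF kernelD(1)[OF solution_kernel[OF p(2)] p(3)]] by (auto simp: measure_support_def)
  qed
  moreover have "s \<in> {1, -1}" using k l s by auto
  moreover have "s * y \<le> s * y'" if "(x, y) \<in> R" "(x', y') \<in> R" "x < x'" for x y x' y'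
  proof -
    from that(1) obtain q where q: "solution q" "x \<in> X" "typical q x" "y \<in> measure_support (q x)"
      by (auto simp: R_def)
    from that(2) obtain q' where q': "solution q'" "x' \<in> X" "typical q' x'" "y' \<in> measure_support (q' x')"
      by (auto simp: R_def)
    show ?thesis
      by (rule two_solutions_ordered[OF q(1) q'(1) q(2) q'(2) that(3) q(3) q'(3) q(4) q'(4)])
  qed
  ultimately obtain T where T: "\<And>x. T x \<in> Y" "\<And>x x'. x \<le> x' \<Longrightarrow> s * T x \<le> s * T x'"
    "\<And>x. continuous (at x within {x..}) T" "countable {x. \<exists>y. (x, y) \<in> R \<and> y \<noteq> T x}"
    by (rule signed_monotone_relation_graph[OF compact_Y]) (assumption+, blast)
  have ctbl: "AE x in \<mu>. \<forall>a\<in>{x. \<exists>y. (x, y) \<in> R \<and> y \<noteq> T x}. x \<noteq> a"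
  proof (subst AE_ball_countable[OF T(4)], intro ballI)
    fix a
    show "AE x in \<mu>. x \<noteq> a"
    proof (cases "a \<in> X")
      case True
      then have "{a} \<in> sets \<mu>" unfolding sets_mu by (rule singleton_sets)
      then have "{a} \<in> null_sets \<mu>" using atomless True by auto
      from AE_not_in[OF this] show ?thesis by eventually_elim simp
    next
      case False
      then show ?thesis by (intro AE_I2) auto
    qed
  qed
  have "represents_kernel \<mu> \<nu> T (\<lambda>x. measure (q x) Y) q" if q: "solution q" for q
  proof (rule represents_kernelI[OF solution_kernel[OF q] T(1)])
    show "AE x in \<mu>. measure_support (q x) \<subseteq> {T x}"
      using AE_typical[OF solution_kernel[OF q]] ctbl AE_space
    proof eventually_elim
      case (elim x)
      show ?case
      proof
        fix y assume "y \<in> measure_support (q x)"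
        then have "(x, y) \<in> R" using elim q unfolding R_def by auto
        then show "y \<in> {T x}" using elim(2) by blast
      qed
    qed
  qed
  then have "solution_map le c \<mu> \<nu> T"
    unfolding solution_map_def
    using T(1,2) continuous_within_subset[OF T(3), of "space \<mu> \<inter> {_..}"]
    by (simp add: monotone_on_def) blast
  then show ?thesis by (rule that)
qed

lemma represents_kernel_value:
  assumes "represents_kernel \<mu> \<nu> T N q" and T: "T \<in> space \<mu> \<rightarrow> space \<nu>"
  shows "AE x in \<mu>. (\<forall>A\<in>sets \<nu>. emeasure (q x) A = ennreal (N x) * indicator A (T x)) \<and> action q x = N x * F x (T x)"
proof -
  have rep: "AE x in \<mu>. q x = scale_measure (ennreal (N x)) (return (restrict_space borel (space \<nu>)) (T x))"
    and N: "\<forall>x\<in>X. 0 \<le> N x"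
    using assms(1) by (simp_all add: represents_kernel_def)
  from rep AE_space show ?thesis
  proof (eventually_elim)
    case (elim x)
    then have x: "x \<in> X" and TY: "T x \<in> Y" using T by auto
    let ?R = "return (restrict_space borel Y) (T x)"
    have qx: "q x = scale_measure (ennreal (N x)) ?R" using elim by simp
    have R: "?R = return \<nu> (T x)" by (intro return_cong) (simp add: sets_nu)
    have "emeasure (q x) A = ennreal (N x) * indicator A (T x)" if "A \<in> sets \<nu>" for A
      using that unfolding qx R by simp
    moreover have "action q x = N x * F x (T x)"
    proof -
      have "sets (q x) = sets \<nu>" unfolding qx R by simp
      from measurable_cong_sets[OF this refl] have Fm: "F x \<in> borel_measurable (q x)"
        using measurable_F2 by blast
      have "action q x = enn2real (\<integral>\<^sup>+y. ennreal (F x y) \<partial>q x)"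
        unfolding action_def using Fm F_pos by (intro integral_eq_nn_integral) (auto simp: less_imp_le)
      also have "(\<integral>\<^sup>+y. ennreal (F x y) \<partial>q x) = ennreal (N x) * (\<integral>\<^sup>+y. ennreal (F x y) \<partial>return \<nu> (T x))"
        unfolding qx R using measurable_F2 by (intro nn_integral_scale_measure) simp
      also have "(\<integral>\<^sup>+y. ennreal (F x y) \<partial>return \<nu> (T x)) = ennreal (F x (T x))"
        using TY measurable_F2 by (intro nn_integral_return) auto
      finally show ?thesis
        using N x F_pos[rule_format, of x "T x"] by (simp add: ennreal_mult[symmetric])
    qed
    ultimately show ?case by blast
  qed
qed

text \<open>Two maps representing the same solution agree almost everywhere where that solution is nonzero. Such
points accumulate at \<open>x\<close> from the right, and right-continuity transfers the agreement to \<open>x\<close>.\<close>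
lemma solution_map_unique:
  assumes T: "solution_map le c \<mu> \<nu> T" and T': "solution_map le c \<mu> \<nu> T'"
    and x: "x \<in> charged_from_right c \<mu> \<nu>"
  shows "T' x = T x"
proof (rule ccontr)
  assume "T' x \<noteq> T x"
  then have gap: "0 < dist (T' x) (T x) / 2" by simp
  have xX: "x \<in> X" using x by (simp add: charged_from_right_def)
  have cont: "continuous (at x within X \<inter> {x..}) T" "continuous (at x within X \<inter> {x..}) T'"
    using T T' xX by (auto simp: solution_map_def)
  obtain d where d: "0 < d" "\<And>t. t \<in> X \<inter> {x..} \<Longrightarrow> dist t x < d \<Longrightarrow> dist (T t) (T x) < dist (T' x) (T x) / 2"
    using cont(1)[unfolded continuous_within_eps_delta, rule_format, OF gap] by metis
  obtain d' where d': "0 < d'" "\<And>t. t \<in> X \<inter> {x..} \<Longrightarrow> dist t x < d' \<Longrightarrow> dist (T' t) (T' x) < dist (T' x) (T x) / 2"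
    using cont(2)[unfolded continuous_within_eps_delta, rule_format, OF gap] by metis
  have "0 < min d d'" using d d' by simp
  then obtain q where q: "solution q"
    and pos: "0 < emeasure \<mu> {t \<in> space \<mu>. x < t \<and> t < x + min d d' \<and> 0 < emeasure (q t) (space \<nu>)}"
    using x unfolding charged_from_right_def by blast
  obtain N N' where N: "represents_kernel \<mu> \<nu> T N q" and N': "represents_kernel \<mu> \<nu> T' N' q"
    using T T' q unfolding solution_map_def by blast
  have TY: "T \<in> space \<mu> \<rightarrow> space \<nu>" "T' \<in> space \<mu> \<rightarrow> space \<nu>"
    using T T' by (simp_all add: solution_map_def)
  have "AE t in \<mu>. 0 < emeasure (q t) Y \<longrightarrow> T t = T' t"
    using represents_kernel_value[OF N TY(1)] represents_kernel_value[OF N' TY(2)] AE_space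
  proof eventually_elim
    case (elim t)
    then have "T t \<in> Y" "T' t \<in> Y" using TY by auto
    then have st: "{T t} \<in> sets \<nu>"
      unfolding sets_nu by (intro singleton_sets)
    have Y: "Y \<in> sets \<nu>" using sets.top[of \<nu>] by simp
    show ?case
    proof (intro impI, rule ccontr)
      assume "0 < emeasure (q t) Y" "T t \<noteq> T' t"
      moreover have "emeasure (q t) Y = ennreal (N t)"
        using elim(1) Y \<open>T t \<in> Y\<close> by simp
      moreover have "emeasure (q t) {T t} = ennreal (N t)" using elim(1) st by simp
      moreover have "emeasure (q t) {T t} = ennreal (N' t) * indicator {T t} (T' t)" using elim(2) st by blast
      ultimately show False by (simp add: indicator_def split: if_splits)
    qed
  qed
  note same = this
  have meas: "{t \<in> space \<mu>. x < t \<and> t < x + min d d' \<and> 0 < emeasure (q t) (space \<nu>)} \<in> sets \<mu>"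
  proof -
    have [measurable]: "(\<lambda>t. emeasure (q t) (space \<nu>)) \<in> borel_measurable \<mu>"
      by (rule kernelD(2)[OF solution_kernel[OF q] sets.top])
    show ?thesis by measurable
  qed
  from exists_in_of_AE[OF pos meas same]
  obtain t where "t \<in> {t \<in> space \<mu>. x < t \<and> t < x + min d d' \<and> 0 < emeasure (q t) (space \<nu>)}"
    "0 < emeasure (q t) Y \<longrightarrow> T t = T' t" by blast
  then have t: "t \<in> X" "x < t" "t < x + min d d'" "T t = T' t" by simp_all
  have "t \<in> X \<inter> {x..}" "dist t x < d" "dist t x < d'" using t by (auto simp: dist_real_def)
  then have "dist (T t) (T x) < dist (T' x) (T x) / 2" "dist (T' t) (T' x) < dist (T' x) (T x) / 2"
    by (simp_all only: d(2) d'(2))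
  moreover have "dist (T' x) (T x) \<le> dist (T' t) (T' x) + dist (T t) (T x)"
    using dist_triangle3[of "T' x" "T x" "T t"] t(4) by simp
  ultimately show False by simp
qed

lemma unique_solution_map_if_atomless:
  assumes "\<forall>x\<in>X. emeasure \<mu> {x} = 0"
  shows "unique_solution_map le c \<mu> \<nu>"
  using solution_map_exists[OF assms] solution_map_unique unfolding unique_solution_map_def by metis

text \<open>If the actions differed on a set of positive measure, the midpoint would be strictly cheaper.\<close>
lemma action_unique_if_strictly_convex:
  assumes strict: "strictly_convex_on {0..} G" and q1: "solution q1" and q2: "solution q2"
  shows "AE x in \<mu>. action q1 x = action q2 x"
proof -
  let ?q = "average_kernel q1 q2"
  note k1 = solution_kernel[OF q1] and k2 = solution_kernel[OF q2]
  have sol: "solution ?q" by (rule solution_average[OF q1 q2])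
  define h where "h x = (G (action q1 x) + G (action q2 x)) / 2 - G (action ?q x)" for x
  have i: "integrable \<mu> (\<lambda>x. (G (action q1 x) + G (action q2 x)) / 2)"
    using solution_integrable[OF q1] solution_integrable[OF q2] by simp
  have h_int: "integrable \<mu> h"
    unfolding h_def using i solution_integrable[OF sol] by (rule Bochner_Integration.integrable_diff)
  have "(\<integral>x. h x \<partial>\<mu>) = 0"
    unfolding h_def using i solution_integrable[OF sol] solution_average(2)[OF q1 q2]
    by (subst Bochner_Integration.integral_diff) auto
  moreover have "AE x in \<mu>. 0 \<le> h x"
  proof (rule AE_I2)
    fix x assume "x \<in> space \<mu>"
    then show "0 \<le> h x"
      using G_midpoint[of "action q1 x" "action q2 x"] action_nonneg
      by (simp add: h_def action_average_kernel[OF k1 k2])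
  qed
  ultimately have "AE x in \<mu>. h x = 0"
    using integral_nonneg_eq_0_iff_AE[OF h_int] by simp
  then show ?thesis
    using AE_space
  proof eventually_elim
    case (elim x)
    show ?case
    proof (rule ccontr)
      assume "action q1 x \<noteq> action q2 x"
      then have "G ((1 - 1 / 2) * action q1 x + 1 / 2 * action q2 x)
          < (1 - 1 / 2) * G (action q1 x) + 1 / 2 * G (action q2 x)"
        using strict[unfolded strictly_convex_on_def, THEN conjunct2, rule_format,
          of "action q1 x" "action q2 x" "1 / 2"] action_nonneg by simp
      moreover have "G (action ?q x) = G ((1 - 1 / 2) * action q1 x + 1 / 2 * action q2 x)"
        using elim(2) by (simp add: action_average_kernel[OF k1 k2] field_simps)
      ultimately show False using elim(1) by (simp add: h_def field_simps)
    qed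
  qed
qed

lemma unique_solution_density_if_strictly_convex:
  assumes "strictly_convex_on {0..} G"
  shows "unique_solution_density le c \<mu> \<nu>"
  unfolding unique_solution_density_def
proof (intro allI impI)
  fix T q1 q2 N1 N2
  assume T: "solution_map le c \<mu> \<nu> T" and q1: "solution q1" and q2: "solution q2"
    and N1: "represents_kernel \<mu> \<nu> T N1 q1" and N2: "represents_kernel \<mu> \<nu> T N2 q2"
  have TY: "T \<in> space \<mu> \<rightarrow> space \<nu>" using T by (simp add: solution_map_def)
  from represents_kernel_value[OF N1 TY] represents_kernel_value[OF N2 TY]
    action_unique_if_strictly_convex[OF assms q1 q2]
  show "AE x in \<mu>. N1 x = N2 x"
  proof eventually_elim
    case (elim x)
    then have "N1 x * F x (T x) = N2 x * F x (T x)" by metis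
    moreover have "F x (T x) \<noteq> 0" using F_pos[rule_format, of x "T x"] by simp
    ultimately show ?case by simp
  qed
qed

end

theorem theorem4p2:
  fixes X Y :: "real set" and \<mu> \<nu> :: "real measure" and q :: "real \<Rightarrow> real measure"
    and G :: "real \<Rightarrow> real" and dG0 :: ereal
    and F :: "real \<Rightarrow> real \<Rightarrow> real" and c :: "real \<Rightarrow> real measure \<Rightarrow> real"
  assumes "compact X" and "compact Y"
    and "\<mu> \<in> prob_measures X" and "\<nu> \<in> prob_measures Y"
    and "convex_on {0..} G" and "\<forall>u>0. G differentiable (at u)"
    and "((\<lambda>u. ereal (deriv G u)) \<longlongrightarrow> dG0) (at_right 0)" and "dG0 < \<infinity>"
    and "\<forall>x y. F x y > 0" and "twice_continuously_differentiable (\<lambda>(x, y). F x y)"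
    and c_def: "c = integral_cost G F"
    and "lower_semicontinuous_map (prod_topology (top_of_set X) (weak_topology Y)) (\<lambda>(x, m). c x m)"
    and "kernel_solution c \<mu> \<nu> q"
  shows
    "((\<forall>x y. mixed_log_derivative F x y < 0) \<longrightarrow>
        (strict_mono_on {0..} G \<longrightarrow> supports_ordered (\<le>) \<mu> q) \<and>
        (strict_antimono_on {0..} G \<and> (dG0 > -\<infinity> \<or> dG0 = -\<infinity> \<and> finite Y) \<longrightarrow>
           supports_ordered (\<ge>) \<mu> q) \<and>
        ((\<forall>x\<in>X. emeasure \<mu> {x} = 0) \<and> measure_support \<mu> = X \<longrightarrow>
           (strict_mono_on {0..} G \<longrightarrow>
              unique_solution_map (\<le>) c \<mu> \<nu> \<and>
              (strictly_convex_on {0..} G \<longrightarrow> unique_solution_density (\<le>) c \<mu> \<nu>)) \<and>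
           (strict_antimono_on {0..} G \<and> (dG0 > -\<infinity> \<or> dG0 = -\<infinity> \<and> finite Y) \<longrightarrow>
              unique_solution_map (\<ge>) c \<mu> \<nu> \<and>
              (strictly_convex_on {0..} G \<longrightarrow> unique_solution_density (\<ge>) c \<mu> \<nu>)))) \<and>
     ((\<forall>x y. mixed_log_derivative F x y > 0) \<longrightarrow>
        (strict_mono_on {0..} G \<longrightarrow> supports_ordered (\<ge>) \<mu> q) \<and>
        (strict_antimono_on {0..} G \<and> (dG0 > -\<infinity> \<or> dG0 = -\<infinity> \<and> finite Y) \<longrightarrow>
           supports_ordered (\<le>) \<mu> q) \<and>
        ((\<forall>x\<in>X. emeasure \<mu> {x} = 0) \<and> measure_support \<mu> = X \<longrightarrow>
           (strict_mono_on {0..} G \<longrightarrow>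
              unique_solution_map (\<ge>) c \<mu> \<nu> \<and>
              (strictly_convex_on {0..} G \<longrightarrow> unique_solution_density (\<ge>) c \<mu> \<nu>)) \<and>
           (strict_antimono_on {0..} G \<and> (dG0 > -\<infinity> \<or> dG0 = -\<infinity> \<and> finite Y) \<longrightarrow>
              unique_solution_map (\<le>) c \<mu> \<nu> \<and>
              (strictly_convex_on {0..} G \<longrightarrow> unique_solution_density (\<le>) c \<mu> \<nu>))))"
proof -
  have transport: "convex_kernel_transport X Y \<mu> \<nu> G F"
    using assms(1-6,9,10) by unfold_locales
  have core: "supports_ordered (\<lambda>a b. k * l * a \<le> k * l * b) \<mu> q \<and>
      ((\<forall>x\<in>X. emeasure \<mu> {x} = 0) \<longrightarrow> unique_solution_map (\<lambda>a b. k * l * a \<le> k * l * b) c \<mu> \<nu>) \<and>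
      (strictly_convex_on {0..} G \<longrightarrow> unique_solution_density (\<lambda>a b. k * l * a \<le> k * l * b) c \<mu> \<nu>)"
    if signs: "k \<in> {1, -1}" "l \<in> {1, -1}" "\<forall>x y. k * mixed_log_derivative F x y < 0" "\<forall>u>0. 0 < l * deriv G u"
    for k l
  proof -
    interpret signed_convex_kernel_transport X Y \<mu> \<nu> G F k l "k * l"
      using transport signs
      by (auto simp: signed_convex_kernel_transport_def signed_convex_kernel_transport_axioms_def)
    show ?thesis
      using supports_ordered_solution assms(13) unique_solution_map_if_atomless
        unique_solution_density_if_strictly_convex
      unfolding c_def by blast
  qed
  \<comment> \<open>Each of the four combinations of signs is one instance of this; \<open>k * l\<close> selects the order.\<close>
  define claim where "claim r \<longleftrightarrow> supports_ordered r \<mu> q \<and>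
      ((\<forall>x\<in>X. emeasure \<mu> {x} = 0) \<longrightarrow> unique_solution_map r c \<mu> \<nu>) \<and>
      (strictly_convex_on {0..} G \<longrightarrow> unique_solution_density r c \<mu> \<nu>)" for r
  have le: "(\<lambda>a b :: real. 1 * 1 * a \<le> 1 * 1 * b) = (\<le>)" "(\<lambda>a b :: real. - 1 * - 1 * a \<le> - 1 * - 1 * b) = (\<le>)"
    "(\<lambda>a b :: real. 1 * - 1 * a \<le> 1 * - 1 * b) = (\<ge>)" "(\<lambda>a b :: real. - 1 * 1 * a \<le> - 1 * 1 * b) = (\<ge>)"
    by auto
  note claims = core[folded claim_def]
  have inc: "\<forall>u>0. 0 < 1 * deriv G u" if "strict_mono_on {0..} G"
    using deriv_pos_if_convex_strict_mono[OF assms(5,6) that] by simp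
  have dec: "\<forall>u>0. 0 < - 1 * deriv G u" if "strict_antimono_on {0..} G"
    using deriv_neg_if_convex_strict_antimono[OF assms(5,6) that] by simp
  have neg: "claim (\<le>)" if "\<forall>x y. mixed_log_derivative F x y < 0" "strict_mono_on {0..} G"
    using claims[of 1 1] inc[OF that(2)] that(1) unfolding le by simp
  have neg': "claim (\<ge>)" if "\<forall>x y. mixed_log_derivative F x y < 0" "strict_antimono_on {0..} G"
    using claims[of 1 "- 1"] dec[OF that(2)] that(1) unfolding le by simp
  have pos: "claim (\<ge>)" if "\<forall>x y. 0 < mixed_log_derivative F x y" "strict_mono_on {0..} G"
    using claims[of "- 1" 1] inc[OF that(2)] that(1) unfolding le by simp
  have pos': "claim (\<le>)" if "\<forall>x y. 0 < mixed_log_derivative F x y" "strict_antimono_on {0..} G"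
    using claims[of "- 1" "- 1"] dec[OF that(2)] that(1) unfolding le by simp
  show ?thesis
    using neg neg' pos pos' unfolding claim_def by blast
qed

end
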